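(* Let $\mathbb{F}$ be an arbitrary field and let $\Phi: M_n(\mathbb{F}) \to M_r(\mathbb{F})$ be a linear map preserving zero products. Then there exist a nonnegative integer $k$ with $nk \le r$, invertible $S \in M_r(\mathbb{F})$ and $R_1 \in M_k(\mathbb{F})$, and a zero product preserving linear map $\Phi_0: M_n(\mathbb{F}) \to M_{r-nk}(\mathbb{F})$ whose values are nilpotent, such that $$\Phi(A) = S\begin{pmatrix} R_1\otimes A & 0\\ 0 & \Phi_0(A)\end{pmatrix}S^{-1}\quad\text{for all } A. \qquad (\ast)$$ Furthermore: (a) If $\Phi$ sends rank one idempotents to idempotents, then $\Phi_0 = 0$, i.e. $\Phi(A) = S\begin{pmatrix} R_1\otimes A & 0\\ 0 & 0_{r-nk}\end{pmatrix}S^{-1}$. $(\ast\ast)$ (b) If $\mathbb{F} = \mathbb{C}$ and $\Phi(A)^* = \Phi(A)$ for every rank one orthogonal projection $A$, then $\Phi$ has the form $(\ast\ast)$ with $R_1 = R_1^*$ and $S$ unitary ($S^{-1}=S^*$). (c) If $\mathbb{F} = \mathbb{R}$ and $\Phi(A) = \Phi(A)^{\mathrm t}$ for every symmetric rank one idempotent $A$, then $\Phi$ has the form $(\ast)$ with $S$ real orthogonal, $\Phi_0(A) = 0$ for every symmetric $A$, and $\Phi_0(X)\Phi_0(Y) = 0$ for all $X,Y \in M_n(\mathbb{R})$. (d) If $\mathbb{F} = \mathbb{C}$, $\Phi(I_n)$ is diagonalizable and $\Phi(A)^{\mathrm t} = \Phi(A)$ for every rank one real symmetric idempotent $A$, then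 $\Phi$ has the form $(\ast)$ with $R_1 = R_1^{\mathrm t}$ and $S$ complex orthogonal ($S^{-1}=S^{\mathrm t}$).
   Context: A map $\Phi$ preserves zero products if $\Phi(A)\Phi(B)=0$ whenever $AB=0$. For $R=[r_{ij}]\in M_k$ and $A\in M_n$, $R\otimes A$ denotes the Kronecker product $[r_{ij}A]\in M_{kn}$. $A^{\mathrm t}$ is the transpose, $A^*$ the conjugate transpose. An orthogonal projection is a matrix with $A=A^2=A^*$. Either block in the displayed forms may be vacuous ($k=0$ or $nk=r$). *)

theory Defs
  imports "Jordan_Normal_Form.Schur_Decomposition" "Jordan_Normal_Form.DL_Rank"
begin

definition kron_mat :: "'a::times mat \<Rightarrow> 'a mat \<Rightarrow> 'a mat" where
  "kron_mat R A = mat (dim_row R * dim_row A) (dim_col R * dim_col A)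
     (\<lambda>(i,j). R $$ (i div dim_row A, j div dim_col A) * A $$ (i mod dim_row A, j mod dim_col A))"

definition block_diag :: "'a::zero mat \<Rightarrow> 'a mat \<Rightarrow> 'a mat" where
  "block_diag X Y = four_block_mat X (0\<^sub>m (dim_row X) (dim_col Y)) (0\<^sub>m (dim_row Y) (dim_col X)) Y"

definition linear_mat_map :: "nat \<Rightarrow> nat \<Rightarrow> ('a::field mat \<Rightarrow> 'a mat) \<Rightarrow> bool" where
  "linear_mat_map n r \<Phi> \<longleftrightarrow>
     (\<forall>A \<in> carrier_mat n n. \<Phi> A \<in> carrier_mat r r) \<and>
     (\<forall>A \<in> carrier_mat n n. \<forall>B \<in> carrier_mat n n. \<Phi> (A + B) = \<Phi> A + \<Phi> B) \<and>
     (\<forall>c. \<forall>A \<in> carrier_mat n n. \<Phi> (c \<cdot>\<^sub>m A) = c \<cdot>\<^sub>m \<Phi> A)"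

definition zero_product_preserving :: "nat \<Rightarrow> nat \<Rightarrow> ('a::field mat \<Rightarrow> 'a mat) \<Rightarrow> bool" where
  "zero_product_preserving n r \<Phi> \<longleftrightarrow>
     (\<forall>A \<in> carrier_mat n n. \<forall>B \<in> carrier_mat n n. A * B = 0\<^sub>m n n \<longrightarrow> \<Phi> A * \<Phi> B = 0\<^sub>m r r)"

definition nilpotent_mat :: "'a::field mat \<Rightarrow> bool" where
  "nilpotent_mat A \<longleftrightarrow> (\<exists>m. A ^\<^sub>m m = 0\<^sub>m (dim_row A) (dim_col A))"

definition diagonalizable_mat :: "'a::field mat \<Rightarrow> bool" where
  "diagonalizable_mat A \<longleftrightarrow> (\<exists>D. diagonal_mat D \<and> similar_mat A D)"

definition mat_rank :: "'a::field mat \<Rightarrow> nat" where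
  "mat_rank A = vec_space.rank (dim_row A) A"

text \<open>The form (*):  Phi(A) = S diag(R1 \<otimes> A, Phi0(A)) T  for all A, where T plays the role of S^{-1}
  (the relation between S and T is imposed separately), R1 is invertible, and Phi0 is a
  zero product preserving linear map M_n \<rightarrow> M_{r-nk} with nilpotent values.\<close>
definition star_form ::
  "nat \<Rightarrow> nat \<Rightarrow> ('a::field mat \<Rightarrow> 'a mat) \<Rightarrow> nat \<Rightarrow> 'a mat \<Rightarrow> 'a mat \<Rightarrow> 'a mat \<Rightarrow> ('a mat \<Rightarrow> 'a mat) \<Rightarrow> bool"
  where
  "star_form n r \<Phi> k S T R1 \<Phi>0 \<longleftrightarrow>
     n * k \<le> r \<and> S \<in> carrier_mat r r \<and> T \<in> carrier_mat r r \<and>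
     R1 \<in> carrier_mat k k \<and> invertible_mat R1 \<and>
     linear_mat_map n (r - n * k) \<Phi>0 \<and> zero_product_preserving n (r - n * k) \<Phi>0 \<and>
     (\<forall>A \<in> carrier_mat n n. nilpotent_mat (\<Phi>0 A)) \<and>
     (\<forall>A \<in> carrier_mat n n. \<Phi> A = S * block_diag (kron_mat R1 A) (\<Phi>0 A) * T)"

end

theory Submission
  imports Defs
begin

text \<open>Idempotents span \<open>M_n\<close>, and for an idempotent \<open>P\<close> zero product preservation gives
  \<open>\<Phi>(AP) \<Phi>(B) = \<Phi>(A) \<Phi>(PB)\<close>; hence \<open>\<Phi>(A) \<Phi>(B) = W \<Phi>(AB) = \<Phi>(AB) W\<close> with \<open>W = \<Phi>(I)\<close>.
  Let \<open>G\<close> be the Drazin inverse of \<open>W\<close> and \<open>Q = WG\<close> its Fitting projection, both of which commute with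
  everything that commutes with \<open>W\<close>. On the complement of \<open>Q\<close>, where \<open>W\<close> is nilpotent, the powers
  \<open>\<Phi>(A)^(m+1) = W^m \<Phi>(A^(m+1))\<close> vanish eventually: this is \<open>\<Phi>0\<close>. On the range of \<open>Q\<close>, \<open>\<Psi> = G\<Phi>\<close> is a unital
  algebra homomorphism, so the images \<open>\<Psi>(E_i0) u_j\<close> of a basis \<open>u_j\<close> of the range of \<open>\<Psi>(E_00)\<close> form a basis in
  which \<open>\<Psi>(A) = I \<otimes> A\<close> and \<open>\<Phi>(A) = R1 \<otimes> A\<close>. If \<open>\<Phi>\<close> maps real symmetric rank one idempotents to
  self-adjoint matrices, then \<open>W\<close>, \<open>G\<close>, \<open>Q\<close> are self-adjoint and \<open>\<Psi>(E_i0)\<close> is adjoint to \<open>\<Psi>(E_0i)\<close>, so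
  orthonormal \<open>u_j\<close> yield an orthonormal basis. For a definite form, \<open>W\<close> vanishes on the complement of \<open>Q\<close>,
  so all products \<open>\<Phi>0(A) \<Phi>0(B)\<close> are zero, and with them all self-adjoint values of \<open>\<Phi>0\<close>.\<close>

subsection \<open>Matrix units and rank one idempotents\<close>

definition unit_mat :: "nat \<Rightarrow> nat \<Rightarrow> nat \<Rightarrow> 'a::{zero,one} mat" where
  "unit_mat n i j = mat n n (\<lambda>p. if p = (i, j) then 1 else 0)"

text \<open>The rank one matrix \<open>f g^t\<close>. Functions in place of vectors allow indicator
  functions to be inserted directly.\<close>

definition outer_mat :: "nat \<Rightarrow> (nat \<Rightarrow> 'a::semiring_0) \<Rightarrow> (nat \<Rightarrow> 'a) \<Rightarrow> 'a mat" where
  "outer_mat n f g = mat n n (\<lambda>(i, j). f i * g j)"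

lemma unit_mat_carrier [simp]: "unit_mat n i j \<in> carrier_mat n n"
  by (simp add: unit_mat_def)

lemma outer_mat_carrier [simp]: "outer_mat n f g \<in> carrier_mat n n"
  by (simp add: outer_mat_def)

lemma mat_mult_entry:
  "i < dim_row A \<Longrightarrow> j < dim_col B \<Longrightarrow> dim_col A = dim_row B \<Longrightarrow>
    (A * B) $$ (i, j) = (\<Sum>l<dim_row B. A $$ (i, l) * B $$ (l, j))"
  by (auto simp: scalar_prod_def lessThan_atLeast0 intro!: sum.cong)

lemma unit_mat_mult:
  "i < n \<Longrightarrow> j < n \<Longrightarrow> k < n \<Longrightarrow> l < n \<Longrightarrow>
    unit_mat n i j * unit_mat n k l = (if j = k then unit_mat n i l else 0\<^sub>m n n :: 'a::semiring_1 mat)"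
  by (rule eq_matI) (auto simp: unit_mat_def scalar_prod_def if_distrib[of "\<lambda>x. x * _"] sum.delta cong: if_cong)

text \<open>Squaring \<open>f g^t\<close> produces the scalar factor \<open>g^t f\<close>, which is
  1.\<close>

lemma outer_mat_idem:
  fixes f g :: "nat \<Rightarrow> 'a::comm_semiring_1"
  assumes "(\<Sum>l<n. g l * f l) = 1"
  shows "outer_mat n f g * outer_mat n f g = outer_mat n f g"
proof (rule eq_matI)
  fix i j assume ij: "i < dim_row (outer_mat n f g)" "j < dim_col (outer_mat n f g)"
  then have "(outer_mat n f g * outer_mat n f g) $$ (i, j) = (\<Sum>l<n. (f i * g l) * (f l * g j))"
    by (simp add: outer_mat_def scalar_prod_def lessThan_atLeast0)
  also have "\<dots> = f i * g j * (\<Sum>l<n. g l * f l)"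
    by (simp add: sum_distrib_left mult_ac)
  finally show "(outer_mat n f g * outer_mat n f g) $$ (i, j) = outer_mat n f g $$ (i, j)"
    using ij by (simp add: assms outer_mat_def)
qed (auto simp: outer_mat_def)

text \<open>The upper bound comes from the product form of the entries. For the lower bound,
  \<open>g^t f = 1\<close> forces an index \<open>j\<close> with
  \<open>g j * f j \<noteq> 0\<close>, so column \<open>j\<close> is nonzero and hence
  independent.\<close>

lemma mat_rank_outer:
  fixes f g :: "nat \<Rightarrow> 'a::field"
  assumes "(\<Sum>l<n. g l * f l) = 1"
  shows "mat_rank (outer_mat n f g) = 1"
proof -
  interpret vec_space "TYPE('a)" n .
  let ?A = "outer_mat n f g"
  have d: "dim_row ?A = n" "dim_col ?A = n"
    by (simp_all add: outer_mat_def)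
  have le: "rank ?A \<le> 1"
    by (rule rank_le_1_product_entries[where f = f and g = g and nc = n]) (auto simp: outer_mat_def)
  obtain j where j: "j < n" "g j * f j \<noteq> 0"
    using assms by (metis (no_types, lifting) lessThan_iff sum.neutral zero_neq_one)
  have "col ?A j $ j = f j * g j"
    using j by (simp add: outer_mat_def)
  then have ne: "col ?A j \<noteq> 0\<^sub>v n"
    using j by (metis index_zero_vec(1) mult.commute)
  have cc: "col ?A j \<in> carrier_vec n"
    by (rule carrier_vecI) (simp add: outer_mat_def)
  have "lin_indpt {col ?A j}"
    using lindep_span[of "{col ?A j}"] ne cc by (simp add: span_empty)
  moreover have "col ?A j \<in> set (cols ?A)"
    using j d by (metis cols_length cols_nth nth_mem)
  ultimately have "rank ?A \<ge> card {col ?A j}"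
    by (intro rank_ge_card_indpt[where nc = n]) auto
  with le show ?thesis
    by (simp add: mat_rank_def d)
qed

lemma mat_unit_induct [consumes 1, case_names zero add smult unit]:
  fixes A :: "'a::semiring_1 mat"
  assumes A: "A \<in> carrier_mat n n"
    and zero: "Pr (0\<^sub>m n n)"
    and add: "\<And>B C. B \<in> carrier_mat n n \<Longrightarrow> C \<in> carrier_mat n n \<Longrightarrow> Pr B \<Longrightarrow> Pr C \<Longrightarrow> Pr (B + C)"
    and smult: "\<And>c B. B \<in> carrier_mat n n \<Longrightarrow> Pr B \<Longrightarrow> Pr (c \<cdot>\<^sub>m B)"
    and unit: "\<And>i j. i < n \<Longrightarrow> j < n \<Longrightarrow> Pr (unit_mat n i j)"
  shows "Pr A"
proof -
  \<comment> \<open>\<open>F I\<close> keeps only the entries of \<open>A\<close> with index in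
    \<open>I\<close>; enlarging \<open>I\<close> by one index adds a multiple of one matrix
    unit.\<close>
  define F where "F I = mat n n (\<lambda>p. if p \<in> I then A $$ p else 0)" for I
  have "Pr (F I)" if "finite I" "I \<subseteq> {..<n} \<times> {..<n}" for I
    using that
  proof (induction I)
    case empty
    have "F {} = 0\<^sub>m n n" by (rule eq_matI) (auto simp: F_def)
    then show ?case using zero by simp
  next
    case (insert p I)
    obtain i j where p: "p = (i, j)" by fastforce
    have "F (insert p I) = F I + A $$ p \<cdot>\<^sub>m unit_mat n i j"
      using insert.hyps p by (intro eq_matI) (auto simp: F_def unit_mat_def)
    moreover have "Pr (A $$ p \<cdot>\<^sub>m unit_mat n i j)"
      using insert.prems p by (intro smult unit) auto
    ultimately show ?case
      using insert by (auto intro!: add simp: F_def)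
  qed
  from this[of "{..<n} \<times> {..<n}"] have "Pr (F ({..<n} \<times> {..<n}))" by simp
  moreover have "F ({..<n} \<times> {..<n}) = A"
    using A by (intro eq_matI) (auto simp: F_def)
  ultimately show ?thesis by simp
qed

lemma diff_from_add_smult:
  fixes A B :: "'a::field mat"
  assumes "A \<in> carrier_mat n n" "B \<in> carrier_mat n n"
  shows "A + (-1) \<cdot>\<^sub>m B = A - B"
  using assms by (intro eq_matI) auto

lemma outer_unit: "unit_mat n i j = (outer_mat n (\<lambda>l. of_bool (l = i)) (\<lambda>l. of_bool (l = j)) :: 'a::semiring_1 mat)"
  by (rule eq_matI) (auto simp: unit_mat_def outer_mat_def)

text \<open>Rank one idempotents span: the diagonal units are such, and for distinct indices
  \<open>E_ij = (E_ii + E_ij) - E_ii\<close>, where \<open>E_ii + E_ij\<close> is a rank one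
  idempotent. Nothing is divided by 2, so every characteristic is covered.\<close>

lemma mat_rank_one_idem_induct [consumes 1, case_names zero add smult idem]:
  fixes A :: "'a::field mat"
  assumes A: "A \<in> carrier_mat n n"
    and zero: "Pr (0\<^sub>m n n)"
    and add: "\<And>B C. B \<in> carrier_mat n n \<Longrightarrow> C \<in> carrier_mat n n \<Longrightarrow> Pr B \<Longrightarrow> Pr C \<Longrightarrow> Pr (B + C)"
    and smult: "\<And>c B. B \<in> carrier_mat n n \<Longrightarrow> Pr B \<Longrightarrow> Pr (c \<cdot>\<^sub>m B)"
    and idem: "\<And>P. P \<in> carrier_mat n n \<Longrightarrow> mat_rank P = 1 \<Longrightarrow> P * P = P \<Longrightarrow> Pr P"
  shows "Pr A"
  using A
proof (induction rule: mat_unit_induct)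
  case (unit i j)
  have diag: "Pr (unit_mat n l l)" if "l < n" for l
    unfolding outer_unit using that
    by (intro idem mat_rank_outer outer_mat_idem) (auto simp: of_bool_def if_distrib[of "\<lambda>x. x * _"] sum.delta cong: if_cong)
  show ?case
  proof (cases "i = j")
    case False
    let ?P = "outer_mat n (\<lambda>l. of_bool (l = i)) (\<lambda>l. of_bool (l = i) + of_bool (l = j)) :: 'a mat"
    have "Pr ?P"
      using unit False
      by (intro idem mat_rank_outer outer_mat_idem)
        (auto simp: of_bool_def distrib_right sum.distrib if_distrib[of "\<lambda>x. x * _"] sum.delta cong: if_cong)
    then have "Pr (?P + (-1) \<cdot>\<^sub>m unit_mat n i i)"
      using diag[OF unit(1)] by (intro add smult) auto
    moreover have "?P + (-1) \<cdot>\<^sub>m unit_mat n i i = unit_mat n i j"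
      by (rule eq_matI) (auto simp: unit_mat_def outer_mat_def)
    ultimately show ?thesis by simp
  qed (use diag unit in simp)
qed (use zero add smult in auto)

text \<open>The library's ring laws for matrices, with dimension equations in place of carrier memberships,
  so that the simplifier can discharge their premises.\<close>

lemma mat_assoc:
  "dim_col A = dim_row B \<Longrightarrow> dim_col B = dim_row C \<Longrightarrow> A * B * C = A * (B * C :: 'a::semiring_0 mat)"
  by (rule assoc_mult_mat[of _ "dim_row A" "dim_row B" _ "dim_row C" _ "dim_col C"]) auto

lemma mat_distl:
  "dim_col A = dim_row B \<Longrightarrow> dim_row C = dim_row B \<Longrightarrow> dim_col C = dim_col B \<Longrightarrow>
    A * (B + C) = A * B + A * (C :: 'a::semiring_0 mat)"
  by (rule mult_add_distrib_mat[of _ "dim_row A" "dim_row B" _ "dim_col B"]) auto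

lemma mat_distr:
  "dim_col A = dim_row C \<Longrightarrow> dim_row B = dim_row A \<Longrightarrow> dim_col B = dim_col A \<Longrightarrow>
    (A + B) * C = A * C + B * (C :: 'a::semiring_0 mat)"
  by (rule add_mult_distrib_mat[of _ "dim_row A" "dim_row C" _ _ "dim_col C"]) auto

lemma mat_diffl:
  "dim_col A = dim_row B \<Longrightarrow> dim_row C = dim_row B \<Longrightarrow> dim_col C = dim_col B \<Longrightarrow>
    A * (B - C) = A * B - A * (C :: 'a::ring mat)"
  by (rule mult_minus_distrib_mat[of _ "dim_row A" "dim_row B" _ "dim_col B"]) auto

lemma mat_diffr:
  "dim_col A = dim_row C \<Longrightarrow> dim_row B = dim_row A \<Longrightarrow> dim_col B = dim_col A \<Longrightarrow>
    (A - B) * C = A * C - B * (C :: 'a::ring mat)"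
  by (rule minus_mult_distrib_mat[of _ "dim_row A" "dim_row C" _ _ "dim_col C"]) auto

lemma mat_smultl: "dim_col A = dim_row B \<Longrightarrow> (c \<cdot>\<^sub>m A) * B = c \<cdot>\<^sub>m (A * B :: 'a::comm_semiring_1 mat)"
  by (rule mult_smult_assoc_mat[of _ "dim_row A" "dim_row B" _ "dim_col B"]) auto

lemma mat_smultr: "dim_col A = dim_row B \<Longrightarrow> A * (c \<cdot>\<^sub>m B) = c \<cdot>\<^sub>m (A * B :: 'a::comm_semiring_1 mat)"
  by (rule mult_smult_distrib[of _ "dim_row A" "dim_row B" _ "dim_col B"]) auto

lemma mat_one_mult: "dim_row A = r \<Longrightarrow> 1\<^sub>m r * A = (A :: 'a::semiring_1 mat)"
  by (rule left_mult_one_mat[of _ _ "dim_col A"]) auto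

lemma mat_mult_one: "dim_col A = r \<Longrightarrow> A * 1\<^sub>m r = (A :: 'a::semiring_1 mat)"
  by (rule right_mult_one_mat[of _ "dim_row A"]) auto

lemma mat_zero_mult: "dim_row A = r \<Longrightarrow> 0\<^sub>m s r * A = (0\<^sub>m s (dim_col A) :: 'a::semiring_0 mat)"
  by (rule left_mult_zero_mat[of _ _ "dim_col A"]) auto

lemma mat_mult_zero: "dim_col A = r \<Longrightarrow> A * 0\<^sub>m r s = (0\<^sub>m (dim_row A) s :: 'a::semiring_0 mat)"
  by (rule right_mult_zero_mat[of _ "dim_row A"]) auto

lemmas mat_ring = mat_assoc mat_distl mat_distr mat_diffl mat_diffr mat_smultl mat_smultr
  mat_one_mult mat_mult_one mat_zero_mult mat_mult_zero

text \<open>Products are kept right-nested, where a trailing factor \<open>Z\<close> hides the pair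
  \<open>A * B\<close>; in this form a commutation rule applies there.\<close>

lemma mat_assoc_swap:
  assumes "A * B = C * (D :: 'a::semiring_0 mat)"
    and "dim_col A = dim_row B" "dim_col B = dim_row Z" "dim_col C = dim_row D" "dim_col D = dim_row Z"
  shows "A * (B * Z) = C * (D * Z)"
  using assms by (metis mat_assoc)

subsection \<open>Block rows and columns\<close>

text \<open>Empty blocks turn juxtaposition into a four block matrix, so that products reduce to
  \<open>mult_four_block_mat\<close>; likewise for \<open>vcat\<close>.\<close>

definition hcat :: "'a::zero mat \<Rightarrow> 'a mat \<Rightarrow> 'a mat" where
  "hcat A B = four_block_mat A B (0\<^sub>m 0 (dim_col A)) (0\<^sub>m 0 (dim_col B))"

definition vcat :: "'a::zero mat \<Rightarrow> 'a mat \<Rightarrow> 'a mat" where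
  "vcat A B = four_block_mat A (0\<^sub>m (dim_row A) 0) B (0\<^sub>m (dim_row B) 0)"

lemma hcat_carrier [simp]:
  "A \<in> carrier_mat r a \<Longrightarrow> B \<in> carrier_mat r b \<Longrightarrow> hcat A B \<in> carrier_mat r (a + b)"
  by (auto simp: hcat_def)

lemma vcat_carrier [simp]:
  "A \<in> carrier_mat a r \<Longrightarrow> B \<in> carrier_mat b r \<Longrightarrow> vcat A B \<in> carrier_mat (a + b) r"
  by (auto simp: vcat_def)

lemma vcat_mult_hcat:
  fixes A B C D :: "'a::semiring_0 mat"
  assumes "A \<in> carrier_mat a r" "B \<in> carrier_mat b r" "C \<in> carrier_mat r c" "D \<in> carrier_mat r d"
  shows "vcat A B * hcat C D = four_block_mat (A * C) (A * D) (B * C) (B * D)"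
  using assms unfolding vcat_def hcat_def
  by (subst mult_four_block_mat[of _ a r _ 0 _ b _ _ c _ d]) auto

lemma hcat_mult_vcat:
  fixes A B C D :: "'a::semiring_0 mat"
  assumes "A \<in> carrier_mat r a" "B \<in> carrier_mat r b" "C \<in> carrier_mat a s" "D \<in> carrier_mat b s"
  shows "hcat A B * vcat C D = A * C + B * D"
  using assms unfolding vcat_def hcat_def
  by (subst mult_four_block_mat[of _ r a _ b _ 0 _ _ s _ 0]) (auto intro!: eq_matI)

lemma mult_hcat:
  fixes M A B :: "'a::semiring_0 mat"
  assumes "M \<in> carrier_mat s r" "A \<in> carrier_mat r a" "B \<in> carrier_mat r b"
  shows "M * hcat A B = hcat (M * A) (M * B)"
proof -
  have "M = four_block_mat M (0\<^sub>m s 0) (0\<^sub>m 0 r) (0\<^sub>m 0 0)"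
    using assms by (intro eq_matI) auto
  then have "M * hcat A B = four_block_mat M (0\<^sub>m s 0) (0\<^sub>m 0 r) (0\<^sub>m 0 0) * hcat A B"
    by simp
  also have "\<dots> = hcat (M * A) (M * B)"
    using assms unfolding hcat_def
    by (subst mult_four_block_mat[of _ s r _ 0 _ 0 _ _ a _ b]) (auto intro!: eq_matI)
  finally show ?thesis .
qed

lemma vcat_mult:
  fixes M A B :: "'a::semiring_0 mat"
  assumes "M \<in> carrier_mat r s" "A \<in> carrier_mat a r" "B \<in> carrier_mat b r"
  shows "vcat A B * M = vcat (A * M) (B * M)"
proof -
  have "M = four_block_mat M (0\<^sub>m r 0) (0\<^sub>m 0 s) (0\<^sub>m 0 0)"
    using assms by (intro eq_matI) auto
  then have "vcat A B * M = vcat A B * four_block_mat M (0\<^sub>m r 0) (0\<^sub>m 0 s) (0\<^sub>m 0 0)"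
    by simp
  also have "\<dots> = vcat (A * M) (B * M)"
    using assms unfolding vcat_def
    by (subst mult_four_block_mat[of _ a r _ 0 _ b _ _ s _ 0]) (auto intro!: eq_matI)
  finally show ?thesis .
qed

text \<open>If \<open>k\<close> exceeded \<open>r\<close>, padding with zeros would make
  \<open>Y\<close> and \<open>X\<close> square with product 1. The reversed product would then be 1
  as well, but its diagonal entry at \<open>r\<close> is 0.\<close>

lemma left_inverse_dim_le:
  fixes X Y :: "'a::field mat"
  assumes X: "X \<in> carrier_mat r k" and Y: "Y \<in> carrier_mat k r" and YX: "Y * X = 1\<^sub>m k"
  shows "k \<le> r"
proof (rule ccontr)
  assume "\<not> k \<le> r"
  then obtain d where k: "k = r + d" "d > 0" by (metis less_imp_add_positive not_le)
  let ?Y = "hcat Y (0\<^sub>m k d)" and ?X = "vcat X (0\<^sub>m d k)"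
  have c: "?Y \<in> carrier_mat k k" "?X \<in> carrier_mat k k"
    using X Y k by (metis hcat_carrier zero_carrier_mat, metis vcat_carrier zero_carrier_mat)
  have "?Y * ?X = 1\<^sub>m k"
    using X Y YX by (subst hcat_mult_vcat[of _ k r _ d _ k]) auto
  then have "?X * ?Y = 1\<^sub>m k"
    using mat_mult_left_right_inverse c by blast
  moreover have "?X * ?Y = four_block_mat (X * Y) (X * 0\<^sub>m k d) (0\<^sub>m d k * Y) (0\<^sub>m d k * 0\<^sub>m k d)"
    using X Y by (subst vcat_mult_hcat[of _ r k _ d _ r _ d]) auto
  moreover have "(four_block_mat (X * Y) (X * 0\<^sub>m k d) (0\<^sub>m d k * Y) (0\<^sub>m d k * 0\<^sub>m k d)) $$ (r, r) = 0"
    using X Y k by simp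
  moreover have "1\<^sub>m k $$ (r, r) = (1 :: 'a)"
    using k by simp
  ultimately show False by (metis zero_neq_one)
qed

subsection \<open>The Drazin inverse\<close>

text \<open>Horner evaluation at \<open>W\<close> of the polynomial whose coefficient list starts
  with the constant term.\<close>

fun pow_sum :: "'a::semiring_1 mat \<Rightarrow> 'a list \<Rightarrow> 'a mat" where
  "pow_sum W [] = 0\<^sub>m (dim_row W) (dim_row W)"
| "pow_sum W (a # as) = a \<cdot>\<^sub>m 1\<^sub>m (dim_row W) + W * pow_sum W as"

lemma pow_sum_carrier [simp]: "W \<in> carrier_mat r r \<Longrightarrow> pow_sum W as \<in> carrier_mat r r"
  by (induction as) auto

lemma pow_sum_commute:
  fixes W A :: "'a::comm_semiring_1 mat"
  assumes "W \<in> carrier_mat r r" "A \<in> carrier_mat r r" "A * W = W * A"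
  shows "A * pow_sum W as = pow_sum W as * A"
proof (induction as)
  case (Cons a as)
  have c: "dim_row (pow_sum W as) = r" "dim_col (pow_sum W as) = r"
    using pow_sum_carrier[OF assms(1), of as] by auto
  have "A * (W * pow_sum W as) = W * (pow_sum W as * A)"
    using assms c Cons mat_assoc_swap[OF assms(3), of "pow_sum W as"] by auto
  then show ?case using assms c by (simp add: mat_ring)
qed (use assms in \<open>simp add: mat_ring\<close>)

lemma pow_mat_Suc_left:
  fixes W :: "'a::semiring_1 mat"
  assumes "W \<in> carrier_mat r r"
  shows "W ^\<^sub>m Suc j = W * W ^\<^sub>m j"
proof (induction j)
  case (Suc j)
  have "W ^\<^sub>m Suc (Suc j) = W * W ^\<^sub>m j * W" using Suc by simp
  then show ?case using assms by (simp add: mat_ring)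
qed (use assms in simp)

lemma pow_mat_plus:
  fixes W :: "'a::semiring_1 mat"
  assumes "W \<in> carrier_mat r r"
  shows "W ^\<^sub>m (i + j) = W ^\<^sub>m i * W ^\<^sub>m j"
  using assms by (induction j) (auto simp: mat_ring)

lemma pow_mat_commute:
  fixes W A :: "'a::semiring_1 mat"
  assumes "W \<in> carrier_mat r r" "A \<in> carrier_mat r r" "A * W = W * A"
  shows "A * W ^\<^sub>m j = W ^\<^sub>m j * A"
proof (induction j)
  case (Suc j)
  have "A * (W ^\<^sub>m j * W) = W ^\<^sub>m j * (A * W)"
    using assms mat_assoc_swap[OF Suc, of W] by simp
  then show ?case using assms by (simp add: mat_ring)
qed (use assms in simp)

text \<open>The power of \<open>W\<close> in front carries the induction: each Horner step passes
  one factor \<open>W\<close> to it.\<close>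

lemma pow_sum_entry:
  fixes W :: "'a::comm_semiring_1 mat"
  assumes W: "W \<in> carrier_mat r r" and ab: "a < r" "b < r"
  shows "(W ^\<^sub>m s * pow_sum W cs) $$ (a, b) = (\<Sum>i<length cs. cs ! i * (W ^\<^sub>m (s + i)) $$ (a, b))"
proof (induction cs arbitrary: s)
  case Nil
  then show ?case using W ab by (simp add: mat_ring)
next
  case (Cons c cs)
  have d: "dim_row (pow_sum W cs) = r" "dim_col (pow_sum W cs) = r"
    using pow_sum_carrier[OF W, of cs] by auto
  have "W ^\<^sub>m s * pow_sum W (c # cs) = c \<cdot>\<^sub>m W ^\<^sub>m s + W ^\<^sub>m Suc s * pow_sum W cs"
    using W d by (simp add: mat_ring)
  then have "(W ^\<^sub>m s * pow_sum W (c # cs)) $$ (a, b)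
      = c * (W ^\<^sub>m s) $$ (a, b) + (W ^\<^sub>m Suc s * pow_sum W cs) $$ (a, b)"
    using W ab d by (simp del: pow_mat.simps)
  also have "\<dots> = (\<Sum>i<length (c # cs). (c # cs) ! i * (W ^\<^sub>m (s + i)) $$ (a, b))"
    unfolding Cons by (simp del: pow_mat.simps sum.lessThan_Suc add: sum.lessThan_Suc_shift)
  finally show ?case .
qed

text \<open>Here \<open>f i t\<close> is coordinate \<open>t\<close> of vector \<open>i\<close>. As
  columns of a square matrix with an additional zero row, the \<open>d + 1\<close> vectors give
  determinant 0, and a kernel vector supplies the coefficients.\<close>

lemma linear_dependence:
  fixes f :: "nat \<Rightarrow> nat \<Rightarrow> 'a::field"
  shows "\<exists>c. (\<exists>i\<le>d. c i \<noteq> 0) \<and> (\<forall>t<d. (\<Sum>i\<le>d. c i * f i t) = 0)"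
proof -
  define M where "M = mat (Suc d) (Suc d) (\<lambda>(t, i). if t < d then f i t else 0)"
  have M: "M \<in> carrier_mat (Suc d) (Suc d)" by (simp add: M_def)
  have "det M = 0"
    by (subst laplace_expansion_row[OF M, of d]) (auto simp: M_def intro!: sum.neutral)
  then obtain v where v: "v \<in> carrier_vec (Suc d)" "v \<noteq> 0\<^sub>v (Suc d)" "M *\<^sub>v v = 0\<^sub>v (Suc d)"
    using det_0_iff_vec_prod_zero_field[OF M] by blast
  have "\<exists>i\<le>d. v $ i \<noteq> 0"
    using v(1,2) by (metis carrier_vecD eq_vecI index_zero_vec less_Suc_eq_le)
  moreover have "(\<Sum>i\<le>d. v $ i * f i t) = 0" if "t < d" for t
  proof -
    have "(M *\<^sub>v v) $ t = (\<Sum>i<Suc d. f i t * v $ i)"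
      using that v(1) by (simp add: M_def scalar_prod_def lessThan_atLeast0)
    then show ?thesis using v(3) that by (simp add: lessThan_Suc_atMost mult.commute)
  qed
  ultimately show ?thesis by blast
qed

text \<open>The powers of \<open>W\<close> with exponents from 0 to \<open>r * r\<close> are one
  more than the dimension \<open>r * r\<close> of the matrix space, hence dependent. Entry
  \<open>(a, b)\<close> is coordinate \<open>a * r + b\<close>.\<close>

lemma mat_annihilated:
  fixes W :: "'a::field mat"
  assumes W: "W \<in> carrier_mat r r"
  shows "\<exists>cs. (\<exists>c\<in>set cs. c \<noteq> 0) \<and> pow_sum W cs = 0\<^sub>m r r"
proof -
  obtain c where c: "\<exists>i\<le>r * r. c i \<noteq> 0"
      "\<And>t. t < r * r \<Longrightarrow> (\<Sum>i\<le>r * r. c i * (W ^\<^sub>m i) $$ (t div r, t mod r)) = 0"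
    using linear_dependence[of "r * r" "\<lambda>i t. (W ^\<^sub>m i) $$ (t div r, t mod r)"] by blast
  let ?cs = "map c [0..<Suc (r * r)]"
  have "pow_sum W ?cs = 0\<^sub>m r r"
  proof (rule eq_matI)
    fix a b assume "a < dim_row (0\<^sub>m r r :: 'a mat)" "b < dim_col (0\<^sub>m r r :: 'a mat)"
    then have ab: "a < r" "b < r" by auto
    have "a * r + b < r * r"
      using ab mult_le_mono1[of "Suc a" r r] by simp
    then have "(\<Sum>i\<le>r * r. c i * (W ^\<^sub>m i) $$ (a, b)) = 0"
      using c(2)[of "a * r + b"] ab by simp
    moreover have "pow_sum W ?cs = W ^\<^sub>m 0 * pow_sum W ?cs"
      using W by (simp add: left_mult_one_mat[OF pow_sum_carrier[OF W]] del: upt_Suc)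
    ultimately show "pow_sum W ?cs $$ (a, b) = 0\<^sub>m r r $$ (a, b)"
      using pow_sum_entry[OF W ab, of 0 ?cs] ab
      by (simp add: lessThan_Suc_atMost[symmetric] del: upt_Suc pow_sum.simps)
  qed (use pow_sum_carrier[OF W, of ?cs] in auto)
  moreover have "\<exists>x\<in>set ?cs. x \<noteq> 0"
    using c(1) by (auto simp: image_iff simp del: upt_Suc)
  ultimately show ?thesis by blast
qed

text \<open>Stripping the vanishing low coefficients of an annihilating polynomial leaves
  \<open>W^m (c + W q(W)) = 0\<close> with \<open>c \<noteq> 0\<close>, so that
  \<open>H = - q(W) / c\<close> works. As a polynomial in \<open>W\<close> it commutes with whatever
  commutes with \<open>W\<close>.\<close>

lemma mat_strongly_pi_regular:
  fixes W :: "'a::field mat"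
  assumes W: "W \<in> carrier_mat r r"
  shows "\<exists>m H. H \<in> carrier_mat r r \<and> W ^\<^sub>m m = W ^\<^sub>m Suc m * H \<and>
    (\<forall>A \<in> carrier_mat r r. A * W = W * A \<longrightarrow> A * H = H * A)"
proof -
  \<comment> \<open>\<open>s\<close> counts the zero coefficients already stripped.\<close>
  have "?thesis" if "\<exists>c\<in>set cs. c \<noteq> 0" "W ^\<^sub>m s * pow_sum W cs = 0\<^sub>m r r" for cs s
    using that
  proof (induction cs arbitrary: s)
    case (Cons c cs)
    have d: "dim_row (pow_sum W cs) = r" "dim_col (pow_sum W cs) = r"
      using pow_sum_carrier[OF W, of cs] by auto
    have eq: "c \<cdot>\<^sub>m W ^\<^sub>m s + W ^\<^sub>m Suc s * pow_sum W cs = 0\<^sub>m r r"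
      using Cons.prems(2) W d by (simp add: mat_ring)
    show ?case
    proof (cases "c = 0")
      case True
      then have "W ^\<^sub>m Suc s * pow_sum W cs = 0\<^sub>m r r"
        using eq W d by (auto simp: mat_eq_iff simp del: pow_mat.simps)
      moreover have "\<exists>c\<in>set cs. c \<noteq> 0" using Cons.prems(1) True by simp
      ultimately show ?thesis by (rule Cons.IH[rotated])
    next
      case False
      let ?H = "(- 1 / c) \<cdot>\<^sub>m pow_sum W cs"
      have "W ^\<^sub>m s = W ^\<^sub>m Suc s * ?H"
      proof (rule eq_matI)
        fix i j assume ij: "i < dim_row (W ^\<^sub>m Suc s * ?H)" "j < dim_col (W ^\<^sub>m Suc s * ?H)"
        then have "(c \<cdot>\<^sub>m W ^\<^sub>m s + W ^\<^sub>m Suc s * pow_sum W cs) $$ (i, j) = 0"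
          unfolding eq using W d by simp
        moreover have "W ^\<^sub>m Suc s * ?H = (- 1 / c) \<cdot>\<^sub>m (W ^\<^sub>m Suc s * pow_sum W cs)"
          using W d by (intro mat_smultr) auto
        ultimately show "(W ^\<^sub>m s) $$ (i, j) = (W ^\<^sub>m Suc s * ?H) $$ (i, j)"
          using ij W d False
          by (simp del: pow_mat.simps index_mult_mat(1) add: field_simps)
             (simp add: eq_neg_iff_add_eq_0)
      qed (use W d in auto)
      moreover have "A * ?H = ?H * A" if "A \<in> carrier_mat r r" "A * W = W * A" for A
        using pow_sum_commute[OF W that] that d W by (simp add: mat_ring)
      moreover have "?H \<in> carrier_mat r r" using W by simp
      ultimately show ?thesis by blast
    qed
  qed simp
  moreover obtain cs where "\<exists>c\<in>set cs. c \<noteq> 0" "pow_sum W cs = 0\<^sub>m r r"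
    using mat_annihilated[OF W] by blast
  moreover from this have "W ^\<^sub>m 0 * pow_sum W cs = 0\<^sub>m r r"
    using W by (simp add: mat_ring)
  ultimately show ?thesis by blast
qed

text \<open>From \<open>W^m = W^(m+1) H\<close> the matrix \<open>K = W H\<close> satisfies
  \<open>W^m K = W^m\<close>. Hence \<open>Q = K^m = H^m W^m\<close> absorbs \<open>K\<close>, which
  makes it idempotent, and \<open>G = H Q\<close> gives \<open>W G = K Q = Q\<close>.\<close>

lemma mat_drazin_inverse:
  fixes W :: "'a::field mat"
  assumes W: "W \<in> carrier_mat r r"
  obtains m Q G where "Q \<in> carrier_mat r r" "G \<in> carrier_mat r r"
    "W * G = Q" "G * W = Q" "Q * Q = Q" "G * Q = G" "Q * G = G" "W ^\<^sub>m m * Q = W ^\<^sub>m m"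
    "\<And>A. A \<in> carrier_mat r r \<Longrightarrow> A * W = W * A \<Longrightarrow> A * G = G * A \<and> A * Q = Q * A"
proof -
  obtain m H where H: "H \<in> carrier_mat r r" and eq: "W ^\<^sub>m m = W ^\<^sub>m Suc m * H"
    and comm: "\<And>A. A \<in> carrier_mat r r \<Longrightarrow> A * W = W * A \<Longrightarrow> A * H = H * A"
    using mat_strongly_pi_regular[OF W] by blast
  define K where "K = W * H"
  have K: "K \<in> carrier_mat r r" using W H by (simp add: K_def)
  have WH: "W * H = H * W" using comm[OF W] by simp
  define Q where "Q = K ^\<^sub>m m"
  define G where "G = H * Q"
  have Q: "Q \<in> carrier_mat r r" and G: "G \<in> carrier_mat r r"
    using K H by (auto simp: Q_def G_def)
  note dims = carrier_matD[OF W] carrier_matD[OF H] carrier_matD[OF K] carrier_matD[OF Q] carrier_matD[OF G]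
    pow_mat_dim_square[OF W] pow_mat_dim_square[OF K] pow_mat_dim_square[OF H]
  have WK: "W ^\<^sub>m m * K = W ^\<^sub>m m"
    using eq dims by (simp add: K_def mat_ring)
  have WKj: "W ^\<^sub>m m * K ^\<^sub>m j = W ^\<^sub>m m" for j
  proof (induction j)
    case (Suc j)
    then show ?case using WK dims by (simp add: mat_assoc[symmetric])
  qed (use dims in \<open>simp add: mat_ring\<close>)
  have Kj: "K ^\<^sub>m j = H ^\<^sub>m j * W ^\<^sub>m j" for j
  proof (induction j)
    case (Suc j)
    have "H * W ^\<^sub>m Suc j = W ^\<^sub>m Suc j * H"
      by (rule pow_mat_commute[OF W H]) (simp add: WH)
    then show ?case using Suc dims by (simp add: K_def mat_ring)
  qed (use dims in \<open>simp add: mat_ring\<close>)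
  have QKj: "Q * K ^\<^sub>m j = Q" for j
    using WKj[of j] dims unfolding Q_def Kj[of m] by (simp add: mat_ring)
  have QQ: "Q * Q = Q" using QKj[of m] by (simp add: Q_def)
  have QK: "Q * K = Q" using QKj[of 1] dims by (simp add: mat_ring)
  have cK: "A * K = K * A" if "A \<in> carrier_mat r r" "A * W = W * A" for A
    using that comm[OF that] dims mat_assoc_swap[OF that(2), of H] by (simp add: K_def mat_ring)
  have cQ: "A * Q = Q * A" if "A \<in> carrier_mat r r" "A * W = W * A" for A
    unfolding Q_def by (rule pow_mat_commute[OF K that(1) cK[OF that]])
  have cG: "A * G = G * A" if "A \<in> carrier_mat r r" "A * W = W * A" for A
    using that comm[OF that] cQ[OF that] dims mat_assoc_swap[OF comm[OF that], of Q] by (simp add: G_def mat_ring)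
  have KQ: "K * Q = Q"
    using pow_mat_commute[OF K K, of m] QK by (simp add: Q_def)
  have WG: "W * G = Q"
    using KQ dims by (simp add: G_def K_def mat_ring)
  have GW: "G * W = Q"
    using cG[OF W] WG by simp
  have GQ: "G * Q = G"
    using QQ dims by (simp add: G_def mat_ring)
  have QG: "Q * G = G"
    using cQ[OF G] GW WG GQ by simp
  have WQ: "W ^\<^sub>m m * Q = W ^\<^sub>m m"
    using WKj[of m] by (simp add: Q_def)
  show ?thesis
    by (rule that[OF Q G WG GW QQ GQ QG WQ]) (use cG cQ in auto)
qed

text \<open>For positive exponents \<open>Q = G^j W^j\<close> and \<open>Q' = W^j G'^j\<close>.
  Since \<open>Q\<close> fixes \<open>W^(m+1)\<close> from the left and \<open>Q'\<close> fixes it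
  from the right, \<open>Q Q'\<close> equals both \<open>Q'\<close> and \<open>Q\<close>. The second
  set of equations will be met by the adjoints of a Drazin inverse.\<close>

lemma mat_drazin_inverse_unique:
  fixes W :: "'a::field mat"
  assumes W: "W \<in> carrier_mat r r"
    and Q: "Q \<in> carrier_mat r r" and G: "G \<in> carrier_mat r r"
    and Q': "Q' \<in> carrier_mat r r" and G': "G' \<in> carrier_mat r r"
    and 1: "W * G = Q" "G * W = Q" "G * Q = G" "Q * W ^\<^sub>m m = W ^\<^sub>m m"
    and 2: "W * G' = Q'" "G' * W = Q'" "Q' * G' = G'" "W ^\<^sub>m m * Q' = W ^\<^sub>m m"
  shows "G = G'" "Q = Q'"
proof -
  note dims = carrier_matD[OF W] carrier_matD[OF Q] carrier_matD[OF G] carrier_matD[OF Q'] carrier_matD[OF G']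
    pow_mat_dim_square[OF W] pow_mat_dim_square[OF G] pow_mat_dim_square[OF G']
  \<comment> \<open>The claim starts at exponent 1, because the zeroth powers would give 1 instead
    of \<open>Q\<close>.\<close>
  have a: "G ^\<^sub>m Suc j * W ^\<^sub>m Suc j = Q" for j
  proof (induction j)
    case (Suc j)
    have "G ^\<^sub>m Suc (Suc j) * W ^\<^sub>m Suc (Suc j) = G * (G ^\<^sub>m Suc j * W ^\<^sub>m Suc j * W)"
      using dims unfolding pow_mat_Suc_left[OF G, of "Suc j"] pow_mat.simps(2)[of W "Suc j"]
      by (simp add: mat_assoc del: pow_mat.simps)
    also have "\<dots> = Q" using Suc 1 dims by (simp add: mat_assoc[symmetric] del: pow_mat.simps)
    finally show ?case .
  qed (use 1 dims in \<open>simp add: mat_ring\<close>)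
  have b: "W ^\<^sub>m Suc j * G' ^\<^sub>m Suc j = Q'" for j
  proof (induction j)
    case (Suc j)
    have "W ^\<^sub>m Suc (Suc j) * G' ^\<^sub>m Suc (Suc j) = W * (W ^\<^sub>m Suc j * G' ^\<^sub>m Suc j * G')"
      using dims unfolding pow_mat_Suc_left[OF W, of "Suc j"] pow_mat.simps(2)[of G' "Suc j"]
      by (simp add: mat_assoc del: pow_mat.simps)
    also have "\<dots> = Q'" using Suc 2 dims by (simp del: pow_mat.simps)
    finally show ?case .
  qed (use 2 dims in \<open>simp add: mat_ring\<close>)
  have "Q * W ^\<^sub>m Suc m = W ^\<^sub>m Suc m"
    using 1(4) dims by (simp add: mat_assoc[symmetric])
  then have "Q * Q' = Q'"
    using dims unfolding b[of m, symmetric] by (simp add: mat_assoc[symmetric] del: pow_mat.simps)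
  moreover have "W ^\<^sub>m Suc m * Q' = W ^\<^sub>m Suc m"
    using 2(4) dims unfolding pow_mat_Suc_left[OF W] by (simp add: mat_assoc)
  then have "Q * Q' = Q"
    using dims unfolding a[of m, symmetric] by (simp add: mat_assoc del: pow_mat.simps)
  ultimately show eq: "Q = Q'" by simp
  have "G = G * (W * G')" using 1 2 eq by simp
  also have "\<dots> = Q * G'" using 1 dims by (simp add: mat_assoc[symmetric])
  finally show "G = G'" using 2 eq by simp
qed

subsection \<open>Linear maps preserving zero products\<close>

lemma mat_eqI_diff:
  fixes A B :: "'a::ring mat"
  assumes "A \<in> carrier_mat r c" "B \<in> carrier_mat r c" "A - B = 0\<^sub>m r c"
  shows "A = B"
proof (rule eq_matI)
  fix i j assume ij: "i < dim_row B" "j < dim_col B"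
  then have "(A - B) $$ (i, j) = 0"
    unfolding assms(3) using assms(2) by simp
  moreover have "(A - B) $$ (i, j) = A $$ (i, j) - B $$ (i, j)"
    using ij by simp
  ultimately show "A $$ (i, j) = B $$ (i, j)"
    by simp
qed (use assms in auto)

lemma linear_mat_mapD:
  assumes "linear_mat_map n r \<Phi>"
  shows "A \<in> carrier_mat n n \<Longrightarrow> \<Phi> A \<in> carrier_mat r r"
    and "A \<in> carrier_mat n n \<Longrightarrow> B \<in> carrier_mat n n \<Longrightarrow> \<Phi> (A + B) = \<Phi> A + \<Phi> B"
    and "A \<in> carrier_mat n n \<Longrightarrow> \<Phi> (c \<cdot>\<^sub>m A) = c \<cdot>\<^sub>m \<Phi> A"
  using assms by (auto simp: linear_mat_map_def)

lemma linear_mat_map_diff: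
  assumes "linear_mat_map n r \<Phi>" "A \<in> carrier_mat n n" "B \<in> carrier_mat n n"
  shows "\<Phi> (A - B) = \<Phi> A - \<Phi> B"
proof -
  have "\<Phi> (A + (-1) \<cdot>\<^sub>m B) = \<Phi> A + (-1) \<cdot>\<^sub>m \<Phi> B"
    using assms by (simp add: linear_mat_mapD[OF assms(1)])
  then show ?thesis
    using assms diff_from_add_smult linear_mat_mapD(1)[OF assms(1)] by metis
qed

lemma linear_mat_map_zero:
  assumes "linear_mat_map n r \<Phi>"
  shows "\<Phi> (0\<^sub>m n n) = 0\<^sub>m r r"
proof -
  have "\<Phi> (0 \<cdot>\<^sub>m 0\<^sub>m n n) = 0 \<cdot>\<^sub>m \<Phi> (0\<^sub>m n n)"
    by (rule linear_mat_mapD(3)[OF assms]) simp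
  then show ?thesis
    using linear_mat_mapD(1)[OF assms, of "0\<^sub>m n n"] by (auto simp: mat_eq_iff)
qed

context
  fixes n r :: nat and \<Phi> :: "'a::field mat \<Rightarrow> 'a mat"
  assumes lin: "linear_mat_map n r \<Phi>" and zpp: "zero_product_preserving n r \<Phi>"
begin

text \<open>For an idempotent \<open>P\<close>, both \<open>(A P) (B - P B)\<close> and \<open>(A - A P) (P B)\<close> vanish; idempotents span.\<close>

lemma zpp_shift:
  assumes X: "X \<in> carrier_mat n n" and A: "A \<in> carrier_mat n n" and B: "B \<in> carrier_mat n n"
  shows "\<Phi> (A * X) * \<Phi> B = \<Phi> A * \<Phi> (X * B)"
  using X
proof (induction rule: mat_rank_one_idem_induct)
  case zero
  then show ?case
    using A B linear_mat_map_zero[OF lin] linear_mat_mapD(1)[OF lin A] linear_mat_mapD(1)[OF lin B]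
    by (simp add: mat_ring)
next
  case (add C D)
  then show ?case
    using A B linear_mat_mapD(1)[OF lin, of "A * C"] linear_mat_mapD(1)[OF lin, of "A * D"]
      linear_mat_mapD(1)[OF lin, of "C * B"] linear_mat_mapD(1)[OF lin, of "D * B"]
      linear_mat_mapD(1)[OF lin A] linear_mat_mapD(1)[OF lin B]
    by (simp add: mat_distl mat_distr linear_mat_mapD(2)[OF lin])
next
  case (smult c C)
  then show ?case
    using A B linear_mat_mapD(1)[OF lin, of "A * C"] linear_mat_mapD(1)[OF lin, of "C * B"]
      linear_mat_mapD(1)[OF lin A] linear_mat_mapD(1)[OF lin B]
    by (simp add: mat_smultl mat_smultr linear_mat_mapD(3)[OF lin])
next
  case (idem P)
  have c: "A * P \<in> carrier_mat n n" "P * B \<in> carrier_mat n n"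
    using A B idem by auto
  note \<Phi>c = linear_mat_mapD(1)[OF lin]
  have PP: "P * (P * B) = P * B"
    using idem B by (metis assoc_mult_mat)
  have "(A * P) * (B - P * B) = 0\<^sub>m n n" "(A - A * P) * (P * B) = 0\<^sub>m n n"
    using A B idem PP by (simp_all add: mat_ring)
  then have "\<Phi> (A * P) * \<Phi> (B - P * B) = 0\<^sub>m r r" "\<Phi> (A - A * P) * \<Phi> (P * B) = 0\<^sub>m r r"
    using zpp A B c unfolding zero_product_preserving_def by (metis minus_carrier_mat)+
  then have "\<Phi> (A * P) * \<Phi> B - \<Phi> (A * P) * \<Phi> (P * B) = 0\<^sub>m r r"
      "\<Phi> A * \<Phi> (P * B) - \<Phi> (A * P) * \<Phi> (P * B) = 0\<^sub>m r r"
    using A B c \<Phi>c[OF A] \<Phi>c[OF B] \<Phi>c[OF c(1)] \<Phi>c[OF c(2)]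
    by (simp_all add: linear_mat_map_diff[OF lin] mat_diffl mat_diffr)
  then have "\<Phi> (A * P) * \<Phi> B = \<Phi> (A * P) * \<Phi> (P * B)" "\<Phi> A * \<Phi> (P * B) = \<Phi> (A * P) * \<Phi> (P * B)"
    using \<Phi>c[OF A] \<Phi>c[OF B] \<Phi>c[OF c(1)] \<Phi>c[OF c(2)]
    by (auto intro!: mat_eqI_diff[of _ r r])
  then show ?case by simp
qed

text \<open>The identity is taken as an outer factor in \<open>zpp_shift\<close>: a product of
  images depends only on the product of the arguments.\<close>

lemma zpp_mult:
  assumes A: "A \<in> carrier_mat n n" and B: "B \<in> carrier_mat n n"
  shows "\<Phi> A * \<Phi> B = \<Phi> (1\<^sub>m n) * \<Phi> (A * B)" and "\<Phi> A * \<Phi> B = \<Phi> (A * B) * \<Phi> (1\<^sub>m n)"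
  using zpp_shift[OF A one_carrier_mat B] zpp_shift[OF B A one_carrier_mat] A B by simp_all

lemma zpp_commute:
  assumes A: "A \<in> carrier_mat n n"
  shows "\<Phi> A * \<Phi> (1\<^sub>m n) = \<Phi> (1\<^sub>m n) * \<Phi> A"
  using zpp_mult(1)[OF A one_carrier_mat] A by simp

text \<open>Every factor after the first contributes one \<open>\<Phi> (1\<^sub>m n)\<close>, so
  nilpotency of the image of the identity on a subspace passes to all images.\<close>

lemma zpp_pow:
  assumes A: "A \<in> carrier_mat n n"
  shows "\<Phi> A ^\<^sub>m Suc j = \<Phi> (1\<^sub>m n) ^\<^sub>m j * \<Phi> (A ^\<^sub>m Suc j)"
proof (induction j)
  case 0
  then show ?case using A linear_mat_mapD(1)[OF lin A] linear_mat_mapD(1)[OF lin one_carrier_mat]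
    by (simp add: mat_ring)
next
  case (Suc j)
  note c = linear_mat_mapD(1)[OF lin one_carrier_mat] linear_mat_mapD(1)[OF lin A]
    linear_mat_mapD(1)[OF lin pow_carrier_mat[OF A]]
  note dims = c[THEN carrier_matD(1)] c[THEN carrier_matD(2)] pow_mat_dim_square[OF c(1)]
  have "\<Phi> A ^\<^sub>m Suc (Suc j) = \<Phi> (1\<^sub>m n) ^\<^sub>m j * \<Phi> (A ^\<^sub>m Suc j) * \<Phi> A"
    using Suc by simp
  also have "\<dots> = \<Phi> (1\<^sub>m n) ^\<^sub>m j * (\<Phi> (A ^\<^sub>m Suc j) * \<Phi> A)"
    using dims by (simp add: mat_assoc del: pow_mat.simps)
  also have "\<dots> = \<Phi> (1\<^sub>m n) ^\<^sub>m j * (\<Phi> (1\<^sub>m n) * \<Phi> (A ^\<^sub>m Suc (Suc j)))"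
    using zpp_mult(1)[OF pow_carrier_mat[OF A, of "Suc j"] A] by simp
  also have "\<dots> = \<Phi> (1\<^sub>m n) ^\<^sub>m Suc j * \<Phi> (A ^\<^sub>m Suc (Suc j))"
    using dims unfolding pow_mat.simps(2)[of "\<Phi> (1\<^sub>m n)"]  by (simp add: mat_assoc del: pow_mat.simps)
  finally show ?case .
qed

end

text \<open>The partial identities \<open>I m\<close> grow by one diagonal unit at a time. The
  entrywise form lets the sum be taken in the field.\<close>

lemma linear_mat_map_unit_sum:
  fixes \<Phi> :: "'a::field mat \<Rightarrow> 'a mat"
  assumes lin: "linear_mat_map n r \<Phi>" and ab: "a < r" "b < r"
  shows "\<Phi> (1\<^sub>m n) $$ (a, b) = (\<Sum>i<n. \<Phi> (unit_mat n i i) $$ (a, b))"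
proof -
  define I where "I m = mat n n (\<lambda>(i, j). if i = j \<and> i < m then 1 else 0 :: 'a)" for m
  have "\<Phi> (I m) $$ (a, b) = (\<Sum>i<m. \<Phi> (unit_mat n i i) $$ (a, b))" if "m \<le> n" for m
    using that
  proof (induction m)
    case 0
    have "I 0 = 0\<^sub>m n n" by (rule eq_matI) (auto simp: I_def)
    then show ?case using linear_mat_map_zero[OF lin] ab by simp
  next
    case (Suc m)
    have "I (Suc m) = I m + unit_mat n m m"
      by (rule eq_matI) (auto simp: I_def unit_mat_def)
    then have "\<Phi> (I (Suc m)) = \<Phi> (I m) + \<Phi> (unit_mat n m m)"
      by (simp add: linear_mat_mapD(2)[OF lin] I_def)
    then show ?case
      using Suc ab linear_mat_mapD(1)[OF lin, of "unit_mat n m m"] by simp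
  qed
  moreover have "I n = 1\<^sub>m n"
    by (rule eq_matI) (auto simp: I_def)
  ultimately show ?thesis by (metis order_refl)
qed

subsection \<open>Adjoints with respect to a field involution\<close>

text \<open>Covers the transpose (\<open>\<sigma>\<close> the identity) and the conjugate transpose
  (\<open>\<sigma> = cnj\<close>) at once.\<close>

definition star :: "('a \<Rightarrow> 'a) \<Rightarrow> 'a mat \<Rightarrow> 'a mat" where
  "star \<sigma> A = mat (dim_col A) (dim_row A) (\<lambda>(i, j). \<sigma> (A $$ (j, i)))"

lemma star_dim [simp]: "dim_row (star \<sigma> A) = dim_col A" "dim_col (star \<sigma> A) = dim_row A"
  by (simp_all add: star_def)

lemma star_carrier [simp]: "A \<in> carrier_mat a b \<Longrightarrow> star \<sigma> A \<in> carrier_mat b a"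
  by (auto simp: star_def)

lemma star_entry: "i < dim_col A \<Longrightarrow> j < dim_row A \<Longrightarrow> star \<sigma> A $$ (i, j) = \<sigma> (A $$ (j, i))"
  by (simp add: star_def)

locale field_involution =
  fixes \<sigma> :: "'a::field \<Rightarrow> 'a"
  assumes sigma_add: "\<sigma> (x + y) = \<sigma> x + \<sigma> y"
    and sigma_mult: "\<sigma> (x * y) = \<sigma> x * \<sigma> y"
    and sigma_sigma: "\<sigma> (\<sigma> x) = x"
begin

lemma sigma_zero: "\<sigma> 0 = 0"
  using sigma_add[of 0 0] by (metis add.right_neutral add_left_imp_eq)

text \<open>An involution is onto, and \<open>\<sigma> 1\<close> acts as a unit on its
  range.\<close>

lemma sigma_one: "\<sigma> 1 = 1"
  by (metis mult_1 mult_1_right sigma_mult sigma_sigma)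

lemma sigma_minus: "\<sigma> (- x) = - \<sigma> x"
  by (metis add.right_inverse add_eq_0_iff sigma_add sigma_zero)

lemma sigma_diff: "\<sigma> (x - y) = \<sigma> x - \<sigma> y"
  by (metis diff_conv_add_uminus sigma_add sigma_minus)

lemma sigma_sum: "\<sigma> (sum f I) = (\<Sum>i\<in>I. \<sigma> (f i))"
  by (induction I rule: infinite_finite_induct) (auto simp: sigma_add sigma_zero)

lemma star_star [simp]: "star \<sigma> (star \<sigma> A) = A"
  by (rule eq_matI) (auto simp: star_def sigma_sigma)

lemma star_one [simp]: "star \<sigma> (1\<^sub>m k) = 1\<^sub>m k"
  by (rule eq_matI) (auto simp: star_def sigma_zero sigma_one)

lemma star_mult: "dim_col A = dim_row B \<Longrightarrow> star \<sigma> (A * B) = star \<sigma> B * star \<sigma> A"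
  by (rule eq_matI) (auto simp: star_def scalar_prod_def sigma_sum sigma_mult mult.commute)

lemma star_diff: "dim_row A = dim_row B \<Longrightarrow> dim_col A = dim_col B \<Longrightarrow> star \<sigma> (A - B) = star \<sigma> A - star \<sigma> B"
  by (rule eq_matI) (auto simp: star_def sigma_diff)

lemma star_smult: "star \<sigma> (c \<cdot>\<^sub>m A) = \<sigma> c \<cdot>\<^sub>m star \<sigma> A"
  by (rule eq_matI) (auto simp: star_def sigma_mult)

lemma star_hcat:
  "A \<in> carrier_mat r a \<Longrightarrow> B \<in> carrier_mat r d \<Longrightarrow> star \<sigma> (hcat A B) = vcat (star \<sigma> A) (star \<sigma> B)"
  by (rule eq_matI) (auto simp: star_def hcat_def vcat_def)

lemma star_pow:
  assumes "W \<in> carrier_mat r r" "star \<sigma> W = W"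
  shows "star \<sigma> (W ^\<^sub>m j) = W ^\<^sub>m j"
proof (induction j)
  case (Suc j)
  have "star \<sigma> (W ^\<^sub>m Suc j) = W * W ^\<^sub>m j"
    using Suc assms by (simp add: star_mult)
  then show ?case using pow_mat_Suc_left[OF assms(1)] by simp
qed (use assms in simp)

lemma star_image_one:
  assumes lin: "linear_mat_map n r \<Phi>"
    and diag: "\<And>i. i < n \<Longrightarrow> star \<sigma> (\<Phi> (unit_mat n i i)) = \<Phi> (unit_mat n i i)"
  shows "star \<sigma> (\<Phi> (1\<^sub>m n)) = \<Phi> (1\<^sub>m n)"
proof (rule eq_matI)
  note d = linear_mat_mapD(1)[OF lin one_carrier_mat, THEN carrier_matD(1)]
    linear_mat_mapD(1)[OF lin one_carrier_mat, THEN carrier_matD(2)]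
  fix i j assume "i < dim_row (\<Phi> (1\<^sub>m n))" "j < dim_col (\<Phi> (1\<^sub>m n))"
  then have ij: "i < r" "j < r" using d by auto
  have "\<sigma> (\<Phi> (unit_mat n l l) $$ (j, i)) = \<Phi> (unit_mat n l l) $$ (i, j)" if "l < n" for l
    using diag[OF that] ij linear_mat_mapD(1)[OF lin, of "unit_mat n l l"]
      star_entry[of i "\<Phi> (unit_mat n l l)" j \<sigma>] by simp
  then show "star \<sigma> (\<Phi> (1\<^sub>m n)) $$ (i, j) = \<Phi> (1\<^sub>m n) $$ (i, j)"
    using ij d by (simp add: star_entry linear_mat_map_unit_sum[OF lin] sigma_sum)
qed (use linear_mat_mapD(1)[OF lin one_carrier_mat] in auto)

end

text \<open>All parts of the theorem are one argument over a field with an involution \<open>\<sigma>\<close>: with \<open>b = False\<close>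
  the duality is vacuous and arbitrary bases are allowed, with \<open>b = True\<close> the left inverses are forced to
  be the \<open>\<sigma>\<close>-adjoints, i.e. the bases are orthonormal for the form given by \<open>\<sigma>\<close>.\<close>

locale mat_duality = field_involution +
  fixes b :: bool
  assumes normalized_vector: "P \<in> carrier_mat r r \<Longrightarrow> P * P = P \<Longrightarrow> P \<noteq> 0\<^sub>m r r \<Longrightarrow> (b \<longrightarrow> star \<sigma> P = P) \<Longrightarrow>
      \<exists>x y. x \<in> carrier_mat r 1 \<and> y \<in> carrier_mat 1 r \<and> P * x = x \<and> y * P = y \<and> y * x = 1\<^sub>m 1 \<and>
        (b \<longrightarrow> y = star \<sigma> x)"
begin

text \<open>Take a biorthogonal system in the range of \<open>P\<close> (columns of
  \<open>X\<close>, rows of \<open>Y\<close>) of the largest size \<open>k\<close>, which is bounded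
  by \<open>r\<close>. The remainder \<open>P - X Y\<close> is again idempotent, and self-adjoint if
  \<open>b\<close>; were it nonzero, a normalized vector in its range would extend the
  system.\<close>

lemma idempotent_factor:
  assumes P: "P \<in> carrier_mat r r" "P * P = P" "b \<longrightarrow> star \<sigma> P = P"
  obtains k X Y where "X \<in> carrier_mat r k" "Y \<in> carrier_mat k r" "X * Y = P" "Y * X = 1\<^sub>m k"
    "b \<longrightarrow> Y = star \<sigma> X"
proof -
  define ok where "ok k \<longleftrightarrow> (\<exists>X Y. X \<in> carrier_mat r k \<and> Y \<in> carrier_mat k r \<and> Y * X = 1\<^sub>m k \<and>
    P * X = X \<and> Y * P = Y \<and> (b \<longrightarrow> Y = star \<sigma> X))" for k
  have "ok 0"
  proof -
    have 1: "0\<^sub>m 0 r * 0\<^sub>m r 0 = (1\<^sub>m 0 :: 'a mat)"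
      by (rule eq_matI) simp_all
    have 2: "P * 0\<^sub>m r 0 = 0\<^sub>m r 0" "0\<^sub>m 0 r * P = 0\<^sub>m 0 r"
      using carrier_matD[OF P(1)] by (simp_all add: mat_ring)
    have 3: "0\<^sub>m 0 r = star \<sigma> (0\<^sub>m r 0)"
      by (rule eq_matI) (simp_all add: star_def)
    show ?thesis unfolding ok_def
      by (intro exI[of _ "0\<^sub>m r 0"] exI[of _ "0\<^sub>m 0 r"] conjI impI zero_carrier_mat 1 2 3)
  qed
  moreover have bound: "j \<le> r" if ok: "ok j" for j
  proof -
    obtain X Y :: "'a mat" where "X \<in> carrier_mat r j" "Y \<in> carrier_mat j r" "Y * X = 1\<^sub>m j"
      using ok unfolding ok_def by blast
    then show ?thesis by (rule left_inverse_dim_le)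
  qed
  moreover define k where "k = (GREATEST k. ok k)"
  ultimately have k: "ok k"
    using GreatestI_nat[of ok 0 r] by simp
  have max: "j \<le> k" if "ok j" for j
    unfolding k_def using that bound by (rule Greatest_le_nat)
  obtain X Y where XY: "X \<in> carrier_mat r k" "Y \<in> carrier_mat k r" "Y * X = 1\<^sub>m k" "P * X = X" "Y * P = Y"
      "b \<longrightarrow> Y = star \<sigma> X"
    using k unfolding ok_def by blast
  note dims = carrier_matD[OF XY(1)] carrier_matD[OF XY(2)] carrier_matD[OF P(1)]
  define P' where "P' = P - X * Y"
  have P': "P' \<in> carrier_mat r r"
    unfolding P'_def by (rule carrier_matI) (simp_all add: dims)
  have YXY: "Y * (X * Y) = Y" "X * (Y * X) = X"
    using XY dims by (simp_all add: mat_assoc[symmetric] mat_ring)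
  have PXY: "P * (X * Y) = X * Y"
    using XY dims by (simp add: mat_assoc[symmetric])
  have PP': "P * P' = P'" "P' * P = P'" "Y * P' = 0\<^sub>m k r" "P' * X = 0\<^sub>m r k"
    using XY P dims YXY PXY by (auto simp: P'_def mat_ring)
  have P'P': "P' * P' = P'"
  proof -
    have "P' * P' = P * P' - X * (Y * P')"
      using dims P' by (subst (1) P'_def) (simp add: mat_ring)
    then show ?thesis using PP' dims P' by (auto simp: mat_ring mat_eq_iff)
  qed
  have sP': "b \<longrightarrow> star \<sigma> P' = P'"
    using XY P dims by (auto simp: P'_def star_diff star_mult)
  have "P' = 0\<^sub>m r r"
  proof (rule ccontr)
    assume "P' \<noteq> 0\<^sub>m r r"
    \<comment> \<open>Since \<open>Y * P'\<close> and \<open>P' * X\<close> vanish, the new pair is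
      orthogonal to the old system, so appending it preserves the left inverse relation.\<close>
    from normalized_vector[OF P' P'P' this sP'] obtain x y
      where xy: "x \<in> carrier_mat r 1" "y \<in> carrier_mat 1 r" "P' * x = x" "y * P' = y" "y * x = 1\<^sub>m 1"
        "b \<longrightarrow> y = star \<sigma> x" by blast
    note d2 = carrier_matD[OF xy(1)] carrier_matD[OF xy(2)] carrier_matD[OF P']
    have "P * (P' * x) = P * P' * x" using dims d2 by (simp add: mat_assoc)
    then have a: "P * x = x" using PP'(1) xy(3) by simp
    have "y * P' * P = y * (P' * P)" using dims d2 by (simp add: mat_assoc)
    then have b: "y * P = y" using PP'(2) xy(4) by simp
    have "Y * (P' * x) = Y * P' * x" using dims d2 by (simp add: mat_assoc)
    then have c: "Y * x = 0\<^sub>m k 1" using PP'(3) xy(3) d2 by (simp add: mat_zero_mult)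
    have "y * P' * X = y * (P' * X)" using dims d2 by (simp add: mat_assoc)
    then have d: "y * X = 0\<^sub>m 1 k" using PP'(4) xy(4) d2 by (simp add: mat_mult_zero)
    have "vcat Y y * hcat X x = 1\<^sub>m (k + 1)"
      using XY xy c d by (simp add: vcat_mult_hcat[of _ k r _ 1 _ k _ 1])
    moreover have "P * hcat X x = hcat X x" "vcat Y y * P = vcat Y y"
      using XY xy a b P by (simp_all add: mult_hcat[of _ r r _ k _ 1] vcat_mult[of _ r r _ k _ 1])
    ultimately have "ok (k + 1)"
      unfolding ok_def using XY xy
      by (intro exI[of _ "hcat X x"] exI[of _ "vcat Y y"])
         (simp add: star_hcat[of _ r k _ 1] del: One_nat_def)
    then show False using max[of "k + 1"] by simp
  qed
  then have "X * Y = P"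
    using mat_eqI_diff[of P r r "X * Y"] P XY unfolding P'_def by auto
  then show ?thesis by (rule that[OF XY(1,2) _ XY(3,6)])
qed

end

subsection \<open>The structure theorem\<close>

text \<open>Column \<open>j * n + i\<close> is column \<open>j\<close> of \<open>F i\<close>: the
  index order of \<open>kron_mat\<close> with an \<open>n\<close> by \<open>n\<close> second
  factor.\<close>

definition interleave_cols :: "nat \<Rightarrow> nat \<Rightarrow> nat \<Rightarrow> (nat \<Rightarrow> 'a mat) \<Rightarrow> 'a mat" where
  "interleave_cols r k n F = mat r (k * n) (\<lambda>(a, c). F (c mod n) $$ (a, c div n))"

definition interleave_rows :: "nat \<Rightarrow> nat \<Rightarrow> nat \<Rightarrow> (nat \<Rightarrow> 'a mat) \<Rightarrow> 'a mat" where
  "interleave_rows r k n F = mat (k * n) r (\<lambda>(c, a). F (c mod n) $$ (c div n, a))"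

lemma interleave_carrier [simp]:
  "interleave_cols r k n F \<in> carrier_mat r (k * n)" "interleave_rows r k n F \<in> carrier_mat (k * n) r"
  by (simp_all add: interleave_cols_def interleave_rows_def)

lemma mod_less_of_mult: "c < k * n \<Longrightarrow> c mod n < (n::nat)"
  by (metis mod_less_divisor mult_0_right not_gr_zero not_less_zero)

lemma div_less_of_mult: "c < k * n \<Longrightarrow> c div n < (k::nat)"
  by (simp add: less_mult_imp_div_less)

text \<open>With \<open>M\<close> an image of \<open>\<Phi>\<close> this exhibits the Kronecker
  structure, with \<open>M\<close> the identity the biorthogonality of the interleaved
  bases.\<close>

lemma interleave_rows_mult_cols:
  fixes F G :: "nat \<Rightarrow> 'a::semiring_0 mat"
  assumes F: "\<And>i. i < n \<Longrightarrow> F i \<in> carrier_mat k r" and G: "\<And>i. i < n \<Longrightarrow> G i \<in> carrier_mat r k"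
    and M: "M \<in> carrier_mat r r" and c: "c < k * n" "d < k * n"
  shows "(interleave_rows r k n F * (M * interleave_cols r k n G)) $$ (c, d) =
    (F (c mod n) * (M * G (d mod n))) $$ (c div n, d div n)"
proof -
  note cd = mod_less_of_mult[OF c(1)] mod_less_of_mult[OF c(2)] div_less_of_mult[OF c(1)] div_less_of_mult[OF c(2)]
  note FG = F[OF cd(1)] G[OF cd(2)]
  let ?R = "interleave_rows r k n F" and ?C = "interleave_cols r k n G"
  have row: "row ?R c = row (F (c mod n)) (c div n)"
    using FG(1) cd c by (intro eq_vecI) (auto simp: interleave_rows_def)
  have col: "col ?C d = col (G (d mod n)) (d div n)"
    using FG(2) cd c by (intro eq_vecI) (auto simp: interleave_cols_def)
  have "(?R * (M * ?C)) $$ (c, d) = row ?R c \<bullet> col (M * ?C) d"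
    using c M by (subst index_mult_mat(1)) (auto simp: interleave_rows_def interleave_cols_def)
  also have "col (M * ?C) d = M *\<^sub>v col ?C d"
    by (rule col_mult2[OF M interleave_carrier(1) c(2)])
  also have "\<dots> = col (M * G (d mod n)) (d div n)"
    unfolding col by (rule col_mult2[OF M FG(2) cd(4), symmetric])
  finally show ?thesis
    unfolding row using FG cd M by (subst index_mult_mat(1)) auto
qed

lemma sum_div_mod:
  fixes f :: "nat \<Rightarrow> nat \<Rightarrow> 'a::comm_monoid_add"
  shows "(\<Sum>c<k * n. f (c mod n) (c div n)) = (\<Sum>i<n. \<Sum>j<k. f i j)"
proof -
  have "(\<Sum>c<k * n. f (c mod n) (c div n)) = (\<Sum>j<k. \<Sum>c = j * n..<j * n + n. f (c mod n) (c div n))"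
    by (rule sum.nat_group[symmetric])
  also have "\<dots> = (\<Sum>j<k. \<Sum>i<n. f i j)"
  proof (rule sum.cong[OF refl])
    fix j
    have "(\<Sum>c = 0 + j * n..<n + j * n. f (c mod n) (c div n)) = (\<Sum>i = 0..<n. f ((i + j * n) mod n) ((i + j * n) div n))"
      by (rule sum.shift_bounds_nat_ivl)
    also have "\<dots> = (\<Sum>i<n. f i j)"
      by (auto simp: lessThan_atLeast0 intro!: sum.cong)
    finally show "(\<Sum>c = j * n..<j * n + n. f (c mod n) (c div n)) = (\<Sum>i<n. f i j)"
      by (simp add: add.commute)
  qed
  also have "\<dots> = (\<Sum>i<n. \<Sum>j<k. f i j)"
    by (rule sum.swap)
  finally show ?thesis .
qed

text \<open>In this order the blocks are summed, which will resolve \<open>Q\<close> into the images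
  of the diagonal units.\<close>

lemma interleave_cols_mult_rows:
  fixes F G :: "nat \<Rightarrow> 'a::semiring_0 mat"
  assumes F: "\<And>i. i < n \<Longrightarrow> F i \<in> carrier_mat r k" and G: "\<And>i. i < n \<Longrightarrow> G i \<in> carrier_mat k r"
    and ab: "a < r" "b < r"
  shows "(interleave_cols r k n F * interleave_rows r k n G) $$ (a, b) = (\<Sum>i<n. (F i * G i) $$ (a, b))"
proof -
  have "(interleave_cols r k n F * interleave_rows r k n G) $$ (a, b)
      = (\<Sum>c<k * n. F (c mod n) $$ (a, c div n) * G (c mod n) $$ (c div n, b))"
    using ab by (simp add: interleave_cols_def interleave_rows_def scalar_prod_def lessThan_atLeast0)
  also have "\<dots> = (\<Sum>i<n. \<Sum>j<k. F i $$ (a, j) * G i $$ (j, b))"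
    by (rule sum_div_mod)
  also have "\<dots> = (\<Sum>i<n. (F i * G i) $$ (a, b))"
  proof (rule sum.cong[OF refl])
    fix i assume "i \<in> {..<n}"
    then have c: "F i \<in> carrier_mat r k" "G i \<in> carrier_mat k r" using F G by auto
    show "(\<Sum>j<k. F i $$ (a, j) * G i $$ (j, b)) = (F i * G i) $$ (a, b)"
      using c ab mat_mult_entry[of a "F i" b "G i"] by auto
  qed
  finally show ?thesis .
qed

lemma star_interleave:
  assumes "\<And>i. i < n \<Longrightarrow> F i \<in> carrier_mat r k"
  shows "star \<sigma> (interleave_cols r k n F) = interleave_rows r k n (\<lambda>i. star \<sigma> (F i))"
proof (rule eq_matI)
  fix c a assume "c < dim_row (interleave_rows r k n (\<lambda>i. star \<sigma> (F i)))"
    "a < dim_col (interleave_rows r k n (\<lambda>i. star \<sigma> (F i)))"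
  then have ca: "c < k * n" "a < r"
    by (auto simp: interleave_rows_def)
  then show "star \<sigma> (interleave_cols r k n F) $$ (c, a) = interleave_rows r k n (\<lambda>i. star \<sigma> (F i)) $$ (c, a)"
    using assms[OF mod_less_of_mult[OF ca(1)]] div_less_of_mult[OF ca(1)]
    by (simp add: star_def interleave_rows_def interleave_cols_def)
qed (auto simp: interleave_rows_def interleave_cols_def)

lemma interleave_rows_cong:
  assumes "\<And>i. i < n \<Longrightarrow> F i = G i"
  shows "interleave_rows r k n F = interleave_rows r k n G"
  unfolding interleave_rows_def
  by (rule eq_matI) (auto simp: assms mod_less_of_mult)

text \<open>A multiplicative linear map turns this into a scalar multiple of one fixed idempotent,
  which is how the entries of \<open>A\<close> enter the Kronecker product.\<close>

lemma unit_mat_sandwich: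
  fixes A :: "'a::comm_semiring_1 mat"
  assumes A: "A \<in> carrier_mat n n" and ij: "i < n" "j < n"
  shows "unit_mat n 0 i * (A * unit_mat n j 0) = A $$ (i, j) \<cdot>\<^sub>m unit_mat n 0 0"
proof (rule eq_matI)
  fix p q assume "p < dim_row (A $$ (i, j) \<cdot>\<^sub>m unit_mat n 0 0)" "q < dim_col (A $$ (i, j) \<cdot>\<^sub>m unit_mat n 0 0)"
  then have pq: "p < n" "q < n" by (auto simp: unit_mat_def)
  have d: "dim_row (unit_mat n i j :: 'a mat) = n" "dim_col (unit_mat n i j :: 'a mat) = n" for i j
    by (simp_all add: unit_mat_def)
  have ue: "unit_mat n a c $$ (p, q) = (if p = a \<and> q = c then 1 else 0 :: 'a)" if "p < n" "q < n" for a c p q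
    using that by (auto simp: unit_mat_def)
  have 1: "(A * unit_mat n j 0) $$ (l, q) = (if q = 0 then A $$ (l, j) else 0)" if "l < n" for l
  proof -
    have "(A * unit_mat n j 0) $$ (l, q) = (\<Sum>m<n. A $$ (l, m) * unit_mat n j 0 $$ (m, q))"
      using that pq A d by (subst mat_mult_entry) auto
    also have "\<dots> = (\<Sum>m<n. if m = j then (if q = 0 then A $$ (l, j) else 0) else 0)"
      using pq by (intro sum.cong) (auto simp: unit_mat_def)
    finally show ?thesis using ij by (simp add: sum.delta)
  qed
  have "(unit_mat n 0 i * (A * unit_mat n j 0)) $$ (p, q)
      = (\<Sum>l<n. unit_mat n 0 i $$ (p, l) * (A * unit_mat n j 0) $$ (l, q))"
    using pq A d by (subst mat_mult_entry) auto
  also have "\<dots> = (\<Sum>l<n. if l = i then (if p = 0 \<and> q = 0 then A $$ (i, j) else 0) else 0)"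
    using pq by (intro sum.cong) (auto simp: ue 1 simp del: index_mult_mat(1))
  also have "\<dots> = (if p = 0 \<and> q = 0 then A $$ (i, j) else 0)"
    using ij by (simp add: sum.delta)
  finally show "(unit_mat n 0 i * (A * unit_mat n j 0)) $$ (p, q) = (A $$ (i, j) \<cdot>\<^sub>m unit_mat n 0 0) $$ (p, q)"
    using pq by (simp add: unit_mat_def)
qed (use A in \<open>auto simp: unit_mat_def\<close>)

section \<open>Splitting along the Fitting decomposition of the image of the identity\<close>

context mat_duality
begin

text \<open>\<open>X\<close>, \<open>Y\<close>, the exponent \<open>m\<close> and the product rule
  are handed out along with the form, because the vanishing results for the nilpotent part are
  derived from them.\<close>

lemma zpp_structure:
  assumes lin: "linear_mat_map n r \<Phi>" and zpp: "zero_product_preserving n r \<Phi>"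
    and sdiag: "\<And>i. b \<Longrightarrow> i < n \<Longrightarrow> star \<sigma> (\<Phi> (unit_mat n i i)) = \<Phi> (unit_mat n i i)"
    and soff: "\<And>i. b \<Longrightarrow> 0 < i \<Longrightarrow> i < n \<Longrightarrow>
      star \<sigma> (\<Phi> (unit_mat n 0 i + unit_mat n i 0)) = \<Phi> (unit_mat n 0 i + unit_mat n i 0)"
  obtains k S T R1 X Y m where
    "S * T = 1\<^sub>m r" "T * S = 1\<^sub>m r" "b \<longrightarrow> T = star \<sigma> S" "b \<longrightarrow> star \<sigma> R1 = R1"
    "star_form n r \<Phi> k S T R1 (\<lambda>A. Y * (\<Phi> A * X))"
    "X \<in> carrier_mat r (r - n * k)" "Y \<in> carrier_mat (r - n * k) r" "b \<longrightarrow> Y = star \<sigma> X"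
    "\<Phi> (1\<^sub>m n) ^\<^sub>m m * X = 0\<^sub>m r (r - n * k)"
    "\<And>A B. A \<in> carrier_mat n n \<Longrightarrow> B \<in> carrier_mat n n \<Longrightarrow>
      (Y * (\<Phi> A * X)) * (Y * (\<Phi> B * X)) = Y * (\<Phi> A * (\<Phi> B * X))"
proof -
  define W where "W = \<Phi> (1\<^sub>m n)"
  note \<Phi>c = linear_mat_mapD(1)[OF lin]
  have W: "W \<in> carrier_mat r r" unfolding W_def by (rule \<Phi>c) simp
  have \<Phi>W: "\<Phi> A * W = W * \<Phi> A" if "A \<in> carrier_mat n n" for A
    unfolding W_def by (rule zpp_commute[OF lin zpp that])
  have \<Phi>mult: "\<Phi> A * \<Phi> B = W * \<Phi> (A * B)" if "A \<in> carrier_mat n n" "B \<in> carrier_mat n n" for A B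
    unfolding W_def by (rule zpp_mult(1)[OF lin zpp that])
  obtain m Q G where Q: "Q \<in> carrier_mat r r" and G: "G \<in> carrier_mat r r"
    and WG: "W * G = Q" and GW: "G * W = Q" and QQ: "Q * Q = Q" and GQ: "G * Q = G" and QG: "Q * G = G"
    and WQ: "W ^\<^sub>m m * Q = W ^\<^sub>m m"
    and comm: "\<And>A. A \<in> carrier_mat r r \<Longrightarrow> A * W = W * A \<Longrightarrow> A * G = G * A \<and> A * Q = Q * A"
    by (rule mat_drazin_inverse[OF W], rule that)
  have Wm: "W ^\<^sub>m m \<in> carrier_mat r r" using W by simp
  note dims = carrier_matD[OF W] carrier_matD[OF Q] carrier_matD[OF G] carrier_matD[OF Wm]
  have \<Phi>d: "dim_row (\<Phi> A) = r" "dim_col (\<Phi> A) = r" if "A \<in> carrier_mat n n" for A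
    using \<Phi>c[OF that] by auto
  have \<Phi>G: "\<Phi> A * G = G * \<Phi> A" and \<Phi>Q: "\<Phi> A * Q = Q * \<Phi> A" if "A \<in> carrier_mat n n" for A
    using comm[OF \<Phi>c[OF that] \<Phi>W[OF that]] by auto
  have WQc: "W * Q = Q * W" using comm[OF W] by simp

  have sW: "star \<sigma> W = W" if b
    unfolding W_def by (rule star_image_one[OF lin sdiag[OF that]])
  \<comment> \<open>For self-adjoint \<open>W\<close> the adjoints of \<open>G\<close> and
    \<open>Q\<close> satisfy the Drazin equations for \<open>W\<close> again, with the sides
    exchanged; uniqueness identifies them with \<open>G\<close> and \<open>Q\<close>.\<close>
  have sGQ: "G = star \<sigma> G" "Q = star \<sigma> Q" if b
  proof -
    note [simp] = sW[OF that]
    have "star \<sigma> Q * star \<sigma> G = star \<sigma> (G * Q)" "W * star \<sigma> G = star \<sigma> (G * W)"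
      "star \<sigma> G * W = star \<sigma> (W * G)" "W ^\<^sub>m m * star \<sigma> Q = star \<sigma> (Q * W ^\<^sub>m m)"
      using dims star_pow[OF W sW[OF that]] by (simp_all add: star_mult)
    moreover have "Q * W ^\<^sub>m m = W ^\<^sub>m m"
      using WQ pow_mat_commute[OF W Q, of m] WQc by simp
    ultimately show "G = star \<sigma> G" "Q = star \<sigma> Q"
      using mat_drazin_inverse_unique[OF W Q G star_carrier[OF Q] star_carrier[OF G], of m]
        WG GW GQ star_pow[OF W sW[OF that]] by simp_all
  qed

  \<comment> \<open>\<open>G\<close> cancels the factor \<open>W\<close> in
    \<open>\<Phi> A * \<Phi> B = W * \<Phi> (A * B)\<close>, which makes \<open>\<Psi>\<close>
    multiplicative.\<close>
  define \<Psi> where "\<Psi> A = G * \<Phi> A" for A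
  have \<Psi>c: "\<Psi> A \<in> carrier_mat r r" if "A \<in> carrier_mat n n" for A
    using G \<Phi>c[OF that] by (simp add: \<Psi>_def)
  have \<Psi>d: "dim_row (\<Psi> A) = r" "dim_col (\<Psi> A) = r" if "A \<in> carrier_mat n n" for A
    using \<Psi>c[OF that] by auto
  have \<Psi>\<Phi>: "\<Psi> A * \<Phi> B = W * \<Psi> (A * B)" if "A \<in> carrier_mat n n" "B \<in> carrier_mat n n" for A B
  proof -
    have "\<Psi> A * \<Phi> B = G * (W * \<Phi> (A * B))"
      using that dims \<Phi>d by (simp add: \<Psi>_def mat_assoc \<Phi>mult)
    also have "\<dots> = W * \<Psi> (A * B)"
      using that dims \<Phi>d WG GW mat_assoc_swap[of G W W G "\<Phi> (A * B)"] by (simp add: \<Psi>_def)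
    finally show ?thesis .
  qed
  have \<Psi>mult: "\<Psi> A * \<Psi> B = \<Psi> (A * B)" if "A \<in> carrier_mat n n" "B \<in> carrier_mat n n" for A B
  proof -
    have "\<Psi> A * \<Psi> B = \<Psi> A * (\<Phi> B * G)"
      using that by (simp add: \<Psi>_def \<Phi>G)
    also have "\<dots> = W * (\<Psi> (A * B) * G)"
      using that dims \<Phi>d \<Psi>d mat_assoc_swap[OF \<Psi>\<Phi>[OF that], of G] by simp
    also have "\<dots> = W * (G * (\<Phi> (A * B) * G))"
      using that dims \<Phi>d by (simp add: \<Psi>_def mat_assoc)
    also have "\<dots> = Q * (G * \<Phi> (A * B))"
      using that dims \<Phi>d WG \<Phi>G by (simp add: mat_assoc[symmetric])
    also have "\<dots> = \<Psi> (A * B)"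
      using that dims \<Phi>d QG by (simp add: \<Psi>_def mat_assoc[symmetric])
    finally show ?thesis .
  qed
  have \<Psi>smult: "\<Psi> (c \<cdot>\<^sub>m A) = c \<cdot>\<^sub>m \<Psi> A" if "A \<in> carrier_mat n n" for c A
    using that dims \<Phi>d by (simp add: \<Psi>_def linear_mat_mapD(3)[OF lin] mat_smultr)
  have Q\<Psi>: "Q * \<Psi> A = \<Psi> A" if "A \<in> carrier_mat n n" for A
    using that dims \<Phi>d QG by (simp add: \<Psi>_def mat_assoc[symmetric])
  have \<Psi>Q: "\<Psi> A * Q = \<Psi> A" if "A \<in> carrier_mat n n" for A
  proof -
    have "G * \<Phi> A * Q = G * (Q * \<Phi> A)"
      using that dims \<Phi>d by (simp add: mat_assoc \<Phi>Q)
    also have "\<dots> = G * Q * \<Phi> A"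
      using that dims \<Phi>d by (simp add: mat_assoc)
    finally show ?thesis using GQ by (simp add: \<Psi>_def)
  qed
  have \<Psi>1: "\<Psi> (1\<^sub>m n) = Q"
    using GW by (simp add: \<Psi>_def W_def)
  let ?E = "unit_mat n :: nat \<Rightarrow> nat \<Rightarrow> 'a mat"

  have s\<Psi>diag: "star \<sigma> (\<Psi> (?E i i)) = \<Psi> (?E i i)" if "b" "i < n" for i
    using that dims \<Phi>d[of "?E i i"] sGQ(1)[OF that(1)] sdiag[OF that] \<Phi>G[of "?E i i"]
    by (simp add: \<Psi>_def star_mult)
  \<comment> \<open>Multiplying the self-adjoint image of \<open>E_0i + E_i0\<close> by that of
    \<open>E_00\<close> on the right and on the left gives \<open>W \<Phi>(E_i0)\<close> and
    \<open>W \<Phi>(E_0i)\<close>, which are therefore adjoint to each other; \<open>G\<close> then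
    removes \<open>W\<close>.\<close>
  have s\<Psi>: "star \<sigma> (\<Psi> (?E i 0)) = \<Psi> (?E 0 i)" if "b" "i < n" for i
  proof (cases "i = 0")
    case False
    then have i: "0 < i" "0 < n" using that by auto
    let ?B = "?E 0 i + ?E i 0"
    have p: "?E 0 0 * ?B = ?E 0 i" "?B * ?E 0 0 = ?E i 0"
      using i that False
      by (simp_all add: mult_add_distrib_mat[of _ n n _ n] add_mult_distrib_mat[of _ n n _ _ n] unit_mat_mult)
    have f: "\<Phi> ?B * \<Phi> (?E 0 0) = W * \<Phi> (?E i 0)" "\<Phi> (?E 0 0) * \<Phi> ?B = W * \<Phi> (?E 0 i)"
      using \<Phi>mult[of ?B "?E 0 0"] \<Phi>mult[of "?E 0 0" ?B] p by simp_all
    have "star \<sigma> (\<Phi> ?B * \<Phi> (?E 0 0)) = \<Phi> (?E 0 0) * \<Phi> ?B"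
      using \<Phi>d[of ?B] \<Phi>d[of "?E 0 0"] sdiag[OF that(1) i(2)] soff[OF that(1) i(1) that(2)] by (simp add: star_mult)
    then have eq: "star \<sigma> (\<Phi> (?E i 0)) * W = \<Phi> (?E 0 i) * W"
      unfolding f using dims \<Phi>d[of "?E i 0"] sW[OF that(1)] \<Phi>W[of "?E 0 i"] by (simp add: star_mult)
    have "star \<sigma> (\<Psi> (?E i 0)) = star \<sigma> (\<Phi> (?E i 0)) * G"
      using dims \<Phi>d[of "?E i 0"] sGQ(1)[OF that(1)] by (simp add: \<Psi>_def star_mult)
    also have "\<dots> = star \<sigma> (\<Phi> (?E i 0)) * (W * (G * G))"
      using dims WG QG by (simp add: mat_assoc[symmetric])
    also have "\<dots> = \<Phi> (?E 0 i) * (W * (G * G))"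
      using mat_assoc_swap[OF eq, of "G * G"] dims \<Phi>d[of "?E i 0"] \<Phi>d[of "?E 0 i"] by simp
    also have "\<dots> = \<Phi> (?E 0 i) * G"
      using dims WG QG by (simp add: mat_assoc[symmetric])
    finally show ?thesis by (simp add: \<Psi>_def \<Phi>G)
  qed (use s\<Psi>diag that in simp)

  define P where "P = \<Psi> (?E 0 0)"
  have Pc: "P \<in> carrier_mat r r" by (simp add: P_def \<Psi>c)
  have EE: "?E 0 0 * ?E 0 0 = ?E 0 0"
  proof (cases "n = 0")
    case True
    show ?thesis unfolding True by (rule eq_matI) (auto simp: unit_mat_def)
  qed (simp add: unit_mat_mult)
  have PP: "P * P = P"
    unfolding P_def using \<Psi>mult[of "?E 0 0" "?E 0 0"] EE by simp
  have sP: "b \<longrightarrow> star \<sigma> P = P"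
  proof
    assume b
    show "star \<sigma> P = P"
    proof (cases "n = 0")
      case True
      \<comment> \<open>For \<open>n = 0\<close> the unit \<open>?E 0 0\<close> is the empty
        identity matrix, and \<open>P\<close> is \<open>Q\<close>.\<close>
      have "?E 0 0 = 1\<^sub>m n" unfolding True by (rule eq_matI) (auto simp: unit_mat_def)
      then show ?thesis using \<Psi>1 sGQ(2)[OF \<open>b\<close>] by (simp add: P_def)
    qed (use s\<Psi>diag \<open>b\<close> P_def in simp)
  qed
  \<comment> \<open>\<open>k\<close> is the rank of \<open>P\<close>: the columns of
    \<open>U\<close> are a basis of its range, and \<open>V\<close> gives the coordinates.\<close>
  obtain k U V where U: "U \<in> carrier_mat r k" and V: "V \<in> carrier_mat k r" and UV: "U * V = P"
    and VU: "V * U = 1\<^sub>m k" and sV: "b \<longrightarrow> V = star \<sigma> U"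
    by (rule idempotent_factor[OF Pc PP sP])
  define Q' where "Q' = 1\<^sub>m r - Q"
  have Q'c: "Q' \<in> carrier_mat r r" unfolding Q'_def by (rule carrier_matI) (simp_all add: dims)
  have Q'Q: "Q' * Q = 0\<^sub>m r r" "Q * Q' = 0\<^sub>m r r"
    using dims QQ minus_r_inv_mat[OF Q] by (simp_all add: Q'_def mat_ring)
  have Q'Q': "Q' * Q' = Q'"
  proof -
    have "Q' * (1\<^sub>m r - Q) = Q' - Q' * Q"
      using dims carrier_matD[OF Q'c] by (simp add: mat_diffl mat_mult_one)
    then show ?thesis unfolding Q'_def[symmetric] Q'Q using Q'c by (auto intro!: eq_matI)
  qed
  have sQ': "b \<longrightarrow> star \<sigma> Q' = Q'"
    using sGQ(2) dims by (simp add: Q'_def star_diff)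
  obtain k' X Y where X: "X \<in> carrier_mat r k'" and Y: "Y \<in> carrier_mat k' r" and XY: "X * Y = Q'"
    and YX: "Y * X = 1\<^sub>m k'" and sY: "b \<longrightarrow> Y = star \<sigma> X"
    by (rule idempotent_factor[OF Q'c Q'Q' sQ'])
  note dims2 = dims carrier_matD[OF Pc] carrier_matD[OF U] carrier_matD[OF V] carrier_matD[OF X] carrier_matD[OF Y]
    carrier_matD[OF Q'c]
  have Q'X: "Q' * X = X" "Y * Q' = Y"
    unfolding XY[symmetric] using dims2 YX by (simp_all add: mat_assoc mat_mult_one)
      (simp add: mat_assoc[symmetric] mat_one_mult)
  have QX: "Q * X = 0\<^sub>m r k'"
  proof -
    have "Q * (Q' * X) = Q * Q' * X" using dims2 by (simp add: mat_assoc)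
    then show ?thesis using Q'X Q'Q dims2 by (simp add: mat_zero_mult)
  qed
  have YQ: "Y * Q = 0\<^sub>m k' r"
  proof -
    have "Y * Q' * Q = Y * (Q' * Q)" using dims2 by (simp add: mat_assoc)
    then show ?thesis using Q'X Q'Q dims2 by (simp add: mat_mult_zero)
  qed
  have PU: "P * U = U" "V * P = V"
    unfolding UV[symmetric] using dims2 VU by (simp_all add: mat_assoc mat_mult_one)
      (simp add: mat_assoc[symmetric] mat_one_mult)

  \<comment> \<open>\<open>\<Psi>(E_i0)\<close> transports the basis \<open>U\<close> to the range
    of \<open>\<Psi>(E_ii)\<close>, and \<open>\<Psi>(E_0i)\<close> transports it back.\<close>
  define F where "F i = \<Psi> (?E i 0) * U" for i
  define H where "H i = V * \<Psi> (?E 0 i)" for i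
  have Fc: "F i \<in> carrier_mat r k" and Hc: "H i \<in> carrier_mat k r" for i
    using U V \<Psi>c[of "?E i 0"] \<Psi>c[of "?E 0 i"] by (auto simp: F_def H_def)
  define S1 where "S1 = interleave_cols r k n F"
  define T1 where "T1 = interleave_rows r k n H"
  have S1: "S1 \<in> carrier_mat r (k * n)" and T1: "T1 \<in> carrier_mat (k * n) r"
    by (simp_all add: S1_def T1_def)
  note dims3 = dims2 carrier_matD[OF S1] carrier_matD[OF T1]
  have sT1: "T1 = star \<sigma> S1" if b
    unfolding S1_def T1_def star_interleave[OF Fc]
    by (rule interleave_rows_cong)
      (use that sV s\<Psi> dims2 \<Psi>d in \<open>simp add: F_def H_def star_mult\<close>)
  \<comment> \<open>\<open>F l * H l = \<Psi>(E_l0) P \<Psi>(E_0l) = \<Psi>(E_ll)\<close>, and these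
    sum to the image of the identity under \<open>\<Psi>\<close>, which is \<open>Q\<close>.\<close>
  have S1T1: "S1 * T1 = Q"
  proof (rule eq_matI)
    fix i j assume "i < dim_row Q" "j < dim_col Q"
    then have ij: "i < r" "j < r" using dims by auto
    have "F l * H l = \<Psi> (?E l l)" if "l < n" for l
    proof -
      have "0 < n" using that by simp
      have "F l * H l = \<Psi> (?E l 0) * (P * \<Psi> (?E 0 l))"
        using dims2 \<Psi>d UV[symmetric] by (simp add: F_def H_def mat_assoc)
      also have "\<dots> = \<Psi> (?E l l)"
        using that \<open>0 < n\<close> by (simp add: P_def \<Psi>mult unit_mat_mult)
      finally show ?thesis .
    qed
    then have "(S1 * T1) $$ (i, j) = (\<Sum>l<n. \<Psi> (?E l l) $$ (i, j))"
      unfolding S1_def T1_def by (subst interleave_cols_mult_rows[OF Fc Hc ij]) auto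
    also have "\<dots> = (G * W) $$ (i, j)"
    proof -
      have "linear_mat_map n r \<Psi>"
        unfolding linear_mat_map_def using \<Psi>c \<Psi>smult dims \<Phi>d
        by (auto simp: \<Psi>_def linear_mat_mapD(2)[OF lin] mat_distl)
      from linear_mat_map_unit_sum[OF this ij] show ?thesis
        by (simp add: \<Psi>_def W_def)
    qed
    finally show "(S1 * T1) $$ (i, j) = Q $$ (i, j)" using GW by simp
  qed (use dims3 in auto)
  \<comment> \<open>\<open>\<Psi>(E_0i) \<Phi>(A) \<Psi>(E_j0) = W \<Psi>(E_0i A E_j0)\<close>, and
    the sandwiched factor is \<open>A_ij P\<close>.\<close>
  have block: "H i * (\<Phi> A * F j) = A $$ (i, j) \<cdot>\<^sub>m (V * (W * U))" if "i < n" "j < n" "A \<in> carrier_mat n n" for i j A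
  proof -
    have "H i * (\<Phi> A * F j) = V * (\<Psi> (?E 0 i) * \<Phi> A * (\<Psi> (?E j 0) * U))"
      using dims2 \<Psi>d \<Phi>d that by (simp add: F_def H_def mat_assoc)
    also have "\<Psi> (?E 0 i) * \<Phi> A * (\<Psi> (?E j 0) * U) = W * (\<Psi> (?E 0 i * A) * \<Psi> (?E j 0) * U)"
      using dims2 \<Psi>d \<Psi>d[OF mult_carrier_mat[OF unit_mat_carrier that(3)], of 0 i] that
      by (simp add: \<Psi>\<Phi> mat_assoc)
    also have "\<Psi> (?E 0 i * A) * \<Psi> (?E j 0) = \<Psi> (?E 0 i * (A * ?E j 0))"
      by (subst \<Psi>mult[OF mult_carrier_mat[OF unit_mat_carrier that(3)] unit_mat_carrier])
        (simp only: assoc_mult_mat[OF unit_mat_carrier that(3) unit_mat_carrier])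
    also have "\<dots> = A $$ (i, j) \<cdot>\<^sub>m P"
      using that by (simp add: unit_mat_sandwich \<Psi>smult P_def)
    finally show ?thesis using dims2 PU by (simp add: mat_smultl mat_smultr)
  qed
  \<comment> \<open>The matrix of \<open>W\<close> on the range of \<open>P\<close> with respect to
    the basis \<open>U\<close>.\<close>
  define R1 where "R1 = V * (W * U)"
  have R1: "R1 \<in> carrier_mat k k" using U V W by (simp add: R1_def)
  have T1\<Phi>S1: "T1 * (\<Phi> A * S1) = kron_mat R1 A" if A: "A \<in> carrier_mat n n" for A
  proof (rule eq_matI)
    fix c d assume "c < dim_row (kron_mat R1 A)" "d < dim_col (kron_mat R1 A)"
    then have cd: "c < k * n" "d < k * n" using R1 A by (auto simp: kron_mat_def)
    have "(T1 * (\<Phi> A * S1)) $$ (c, d) = (H (c mod n) * (\<Phi> A * F (d mod n))) $$ (c div n, d div n)"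
      unfolding T1_def S1_def by (rule interleave_rows_mult_cols[OF Hc Fc \<Phi>c[OF A] cd])
    also have "\<dots> = A $$ (c mod n, d mod n) * R1 $$ (c div n, d div n)"
      unfolding block[OF mod_less_of_mult[OF cd(1)] mod_less_of_mult[OF cd(2)] A] R1_def[symmetric]
      using R1 cd by (simp add: div_less_of_mult)
    finally show "(T1 * (\<Phi> A * S1)) $$ (c, d) = kron_mat R1 A $$ (c, d)"
      using R1 A cd by (simp add: kron_mat_def mult.commute)
  qed (use R1 that dims3 in \<open>auto simp: kron_mat_def\<close>)
  have T1S1: "T1 * S1 = 1\<^sub>m (k * n)"
  proof (rule eq_matI)
    fix c d assume "c < dim_row (1\<^sub>m (k * n) :: 'a mat)" "d < dim_col (1\<^sub>m (k * n) :: 'a mat)"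
    then have cd: "c < k * n" "d < k * n" by auto
    note md = mod_less_of_mult[OF cd(1)] mod_less_of_mult[OF cd(2)] div_less_of_mult[OF cd(1)] div_less_of_mult[OF cd(2)]
    have "(T1 * S1) $$ (c, d) = (T1 * (1\<^sub>m r * S1)) $$ (c, d)"
      using dims3 by (simp add: mat_one_mult)
    also have "\<dots> = (H (c mod n) * (1\<^sub>m r * F (d mod n))) $$ (c div n, d div n)"
      unfolding T1_def S1_def by (rule interleave_rows_mult_cols[OF Hc Fc one_carrier_mat cd])
    also have "H (c mod n) * (1\<^sub>m r * F (d mod n)) = V * (\<Psi> (?E 0 (c mod n)) * \<Psi> (?E (d mod n) 0) * U)"
      using dims2 \<Psi>d by (simp add: F_def H_def mat_assoc mat_one_mult)
    also have "\<Psi> (?E 0 (c mod n)) * \<Psi> (?E (d mod n) 0) = (1\<^sub>m n :: 'a mat) $$ (c mod n, d mod n) \<cdot>\<^sub>m P"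
    proof -
      have "?E 0 (c mod n) * ?E (d mod n) 0 = 1\<^sub>m n $$ (c mod n, d mod n) \<cdot>\<^sub>m ?E 0 0"
        using unit_mat_sandwich[OF one_carrier_mat md(1,2), where 'a = 'a] by (simp add: mat_one_mult unit_mat_def)
      then show ?thesis by (simp add: \<Psi>mult \<Psi>smult P_def)
    qed
    also have "V * ((1\<^sub>m n :: 'a mat) $$ (c mod n, d mod n) \<cdot>\<^sub>m P * U) = (1\<^sub>m n :: 'a mat) $$ (c mod n, d mod n) \<cdot>\<^sub>m 1\<^sub>m k"
      using dims2 PU VU by (simp add: mat_smultl mat_smultr)
    \<comment> \<open>An index below \<open>k * n\<close> is determined by its quotient and
      remainder modulo \<open>n\<close>, so the two Kronecker deltas combine into one.\<close>
    also have "\<dots> $$ (c div n, d div n) = 1\<^sub>m (k * n) $$ (c, d)"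
      using cd md by (auto) (metis div_mult_mod_eq)+
    finally show "(T1 * S1) $$ (c, d) = 1\<^sub>m (k * n) $$ (c, d)" .
  qed (use dims3 in auto)

  \<comment> \<open>The inverse of \<open>R1\<close> is \<open>V G U\<close>: \<open>W\<close> and
    \<open>G\<close> commute with \<open>P\<close> and are inverse to each other on the range of
    \<open>Q\<close>, which contains that of \<open>P\<close>.\<close>
  have R1inv: "invertible_mat R1"
  proof -
    have PW: "P * W = W * P" unfolding P_def \<Psi>_def
    proof -
      have "G * \<Phi> (?E 0 0) * W = G * (W * \<Phi> (?E 0 0))"
        using dims \<Phi>d \<Phi>W by (simp add: mat_assoc)
      then show "G * \<Phi> (?E 0 0) * W = W * (G * \<Phi> (?E 0 0))"
        using dims \<Phi>d GW WG mat_assoc_swap[of G W W G "\<Phi> (?E 0 0)"] by simp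
    qed
    have PG: "P * G = G * P"
      using comm[OF Pc PW] by simp
    have QU: "Q * U = U"
    proof -
      have "Q * (P * U) = Q * P * U" using dims2 by (simp add: mat_assoc)
      then show ?thesis using PU Q\<Psi>[of "?E 0 0"] by (simp add: P_def)
    qed
    have "R1 * (V * (G * U)) = V * (W * (U * V * (G * U)))"
      using dims2 by (simp add: R1_def mat_assoc)
    also have "U * V * (G * U) = G * U"
      unfolding UV using mat_assoc_swap[OF PG, of U] dims2 PU by simp
    also have "W * (G * U) = U"
      using dims2 WG QU by (simp add: mat_assoc[symmetric])
    finally have 1: "R1 * (V * (G * U)) = 1\<^sub>m k" using VU by simp
    have "V * (G * U) * R1 = V * (G * (U * V * (W * U)))"
      using dims2 by (simp add: R1_def mat_assoc)
    also have "U * V * (W * U) = W * U"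
      unfolding UV using mat_assoc_swap[OF PW, of U] dims2 PU by simp
    also have "G * (W * U) = U"
      using dims2 GW QU by (simp add: mat_assoc[symmetric])
    finally have 2: "V * (G * U) * R1 = 1\<^sub>m k" using VU by simp
    show ?thesis
      unfolding invertible_mat_def inverts_mat_def
      using 1 2 R1 V by (intro conjI exI[of _ "V * (G * U)"]) auto
  qed

  define S where "S = hcat S1 X"
  define T where "T = vcat T1 Y"
  have Sc: "S \<in> carrier_mat r (k * n + k')" and Tc: "T \<in> carrier_mat (k * n + k') r"
    using S1 T1 X Y by (auto simp: S_def T_def)
  have ST: "S * T = 1\<^sub>m r"
  proof -
    have "S * T = Q + Q'"
      unfolding S_def T_def using S1T1 XY by (simp add: hcat_mult_vcat[OF S1 X T1 Y])
    also have "\<dots> = 1\<^sub>m r"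
      using dims by (intro eq_matI) (auto simp: Q'_def)
    finally show ?thesis .
  qed
  have T1Q: "T1 * Q = T1"
    unfolding S1T1[symmetric] using dims3 T1S1 by (simp add: mat_assoc[symmetric] mat_one_mult)
  have QS1: "Q * S1 = S1"
    unfolding S1T1[symmetric] using dims3 T1S1 by (simp add: mat_assoc mat_mult_one)
  \<comment> \<open>A matrix commuting with \<open>Q\<close> respects the splitting:
    \<open>Q\<close> is inserted next to \<open>T1\<close> or \<open>S1\<close>, which it fixes, and
    moved across to \<open>X\<close> or \<open>Y\<close>, which it annihilates.\<close>
  have off: "T1 * (M * X) = 0\<^sub>m (k * n) k'" "Y * (M * S1) = 0\<^sub>m k' (k * n)"
    if M: "M \<in> carrier_mat r r" "M * Q = Q * M" for M
  proof -
    have "T1 * Q * (M * X) = T1 * (M * (Q * X))"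
      using dims3 M mat_assoc_swap[OF M(2), of X] by (simp add: mat_assoc)
    then show "T1 * (M * X) = 0\<^sub>m (k * n) k'"
      using T1Q QX dims3 M by (simp add: mat_mult_zero)
    have "Y * (M * (Q * S1)) = Y * Q * (M * S1)"
      using dims3 M mat_assoc_swap[OF M(2), of S1] by (simp add: mat_assoc)
    then show "Y * (M * S1) = 0\<^sub>m k' (k * n)"
      using QS1 YQ dims3 M by (simp add: mat_zero_mult)
  qed
  have TS: "T * S = 1\<^sub>m (k * n + k')"
    unfolding S_def T_def using off[of "1\<^sub>m r"] T1S1 YX dims3
    by (simp add: vcat_mult_hcat[OF T1 Y S1 X] mat_one_mult mat_mult_one)
  \<comment> \<open>Each of the two one-sided inverse relations gives one inequality.\<close>
  have "r = k * n + k'"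
    using left_inverse_dim_le[OF Sc Tc TS] left_inverse_dim_le[OF Tc Sc ST] by simp
  then have rk: "r = n * k + k'" "r - n * k = k'" "n * k \<le> r" by (simp_all add: mult.commute)
  have form: "\<Phi> A = S * block_diag (kron_mat R1 A) (Y * (\<Phi> A * X)) * T" if A: "A \<in> carrier_mat n n" for A
  proof -
    have "T * (\<Phi> A * S) = four_block_mat (T1 * (\<Phi> A * S1)) (T1 * (\<Phi> A * X)) (Y * (\<Phi> A * S1)) (Y * (\<Phi> A * X))"
      unfolding S_def T_def mult_hcat[OF \<Phi>c[OF A] S1 X]
      by (rule vcat_mult_hcat[OF T1 Y]) (use \<Phi>c[OF A] S1 X in auto)
    also have "\<dots> = block_diag (kron_mat R1 A) (Y * (\<Phi> A * X))"
      unfolding T1\<Phi>S1[OF A] off[OF \<Phi>c[OF A] \<Phi>Q[OF A]] block_diag_def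
      using R1 A dims3 by (simp add: kron_mat_def)
    finally have "S * block_diag (kron_mat R1 A) (Y * (\<Phi> A * X)) * T = S * (T * (\<Phi> A * S)) * T"
      by simp
    also have "\<dots> = S * T * \<Phi> A * (S * T)"
      using Sc Tc \<Phi>d[OF A] by (simp add: mat_assoc)
    finally show ?thesis using ST \<Phi>d[OF A] by (simp add: mat_one_mult mat_mult_one)
  qed
  have prod: "(Y * (M * X)) * (Y * (N * X)) = Y * (M * (N * X))"
    if M: "M \<in> carrier_mat r r" and N: "N \<in> carrier_mat r r" "N * Q = Q * N" for M N
  proof -
    have NQ': "Q' * N = N * Q'"
      using dims N by (simp add: Q'_def mat_ring)
    have "(Y * (M * X)) * (Y * (N * X)) = Y * (M * (X * Y * (N * X)))"
      using dims2 M N by (simp add: mat_assoc)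
    also have "X * Y * (N * X) = N * X"
      unfolding XY using mat_assoc_swap[OF NQ', of X] Q'X dims2 N by simp
    finally show ?thesis .
  qed
  have WmX: "W ^\<^sub>m m * X = 0\<^sub>m r k'"
  proof -
    have "W ^\<^sub>m m * X = W ^\<^sub>m m * Q * X" using WQ by simp
    also have "\<dots> = W ^\<^sub>m m * (Q * X)" using dims2 by (simp add: mat_assoc)
    finally show ?thesis using QX dims2 by (simp add: mat_mult_zero)
  qed
  have pow: "(Y * (\<Phi> A * X)) ^\<^sub>m j = Y * (\<Phi> A ^\<^sub>m j * X)" if A: "A \<in> carrier_mat n n" for A j
  proof (induction j)
    case (Suc j)
    have c: "\<Phi> A ^\<^sub>m j \<in> carrier_mat r r" using \<Phi>c[OF A] by simp
    have "(Y * (\<Phi> A * X)) ^\<^sub>m Suc j = Y * (\<Phi> A ^\<^sub>m j * X) * (Y * (\<Phi> A * X))"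
      using Suc by simp
    also have "\<dots> = Y * (\<Phi> A ^\<^sub>m j * (\<Phi> A * X))"
      by (rule prod[OF c \<Phi>c[OF A] \<Phi>Q[OF A]])
    finally show ?case using c \<Phi>c[OF A] dims2 by (simp add: mat_assoc)
  qed (use YX dims2 \<Phi>d[OF A] in \<open>simp add: mat_one_mult\<close>)
  \<comment> \<open>The power with exponent \<open>m + 1\<close> is
    \<open>Y \<Phi>(A^(m+1)) W^m X\<close>, and \<open>W^m\<close> annihilates
    \<open>X\<close>.\<close>
  have nil: "nilpotent_mat (Y * (\<Phi> A * X))" if A: "A \<in> carrier_mat n n" for A
  proof -
    have Ac: "A ^\<^sub>m Suc m \<in> carrier_mat n n" using A by (rule pow_carrier_mat)
    have "\<Phi> A ^\<^sub>m Suc m * X = W ^\<^sub>m m * \<Phi> (A ^\<^sub>m Suc m) * X"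
      unfolding zpp_pow[OF lin zpp A] W_def ..
    also have "\<dots> = \<Phi> (A ^\<^sub>m Suc m) * W ^\<^sub>m m * X"
      using pow_mat_commute[OF W \<Phi>c[OF Ac] \<Phi>W[OF Ac], of m] by simp
    also have "\<dots> = \<Phi> (A ^\<^sub>m Suc m) * (W ^\<^sub>m m * X)"
      using \<Phi>d[OF Ac] dims2 by (simp add: mat_assoc del: pow_mat.simps)
    also have "\<dots> = 0\<^sub>m r k'"
      unfolding WmX using \<Phi>d[OF Ac] by (simp add: mat_mult_zero del: pow_mat.simps)
    finally have "(Y * (\<Phi> A * X)) ^\<^sub>m Suc m = 0\<^sub>m k' k'"
      unfolding pow[OF A] using dims2 by (simp add: mat_mult_zero)
    then show ?thesis
      unfolding nilpotent_mat_def using dims2 by (intro exI[of _ "Suc m"]) simp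
  qed
  have sf: "star_form n r \<Phi> k S T R1 (\<lambda>A. Y * (\<Phi> A * X))"
    unfolding star_form_def rk(2)
  proof (intro conjI)
    show "linear_mat_map n k' (\<lambda>A. Y * (\<Phi> A * X))"
      unfolding linear_mat_map_def
    proof (intro conjI ballI allI)
      fix A :: "'a mat" assume A: "A \<in> carrier_mat n n"
      show "Y * (\<Phi> A * X) \<in> carrier_mat k' k'"
        by (intro mult_carrier_mat[OF Y] mult_carrier_mat[OF \<Phi>c[OF A] X])
      show "Y * (\<Phi> (c \<cdot>\<^sub>m A) * X) = c \<cdot>\<^sub>m (Y * (\<Phi> A * X))" for c
        unfolding linear_mat_mapD(3)[OF lin A] using dims2 \<Phi>d[OF A] by (simp add: mat_smultl mat_smultr)
      fix B :: "'a mat" assume B: "B \<in> carrier_mat n n"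
      show "Y * (\<Phi> (A + B) * X) = Y * (\<Phi> A * X) + Y * (\<Phi> B * X)"
        unfolding linear_mat_mapD(2)[OF lin A B] using dims2 \<Phi>d[OF A] \<Phi>d[OF B]
        by (simp add: mat_distl mat_distr)
    qed
    show "zero_product_preserving n k' (\<lambda>A. Y * (\<Phi> A * X))"
      unfolding zero_product_preserving_def
    proof (intro ballI impI)
      fix A B :: "'a mat" assume AB: "A \<in> carrier_mat n n" "B \<in> carrier_mat n n" "A * B = 0\<^sub>m n n"
      then have z: "\<Phi> A * \<Phi> B = 0\<^sub>m r r" using zpp by (simp add: zero_product_preserving_def)
      have "(Y * (\<Phi> A * X)) * (Y * (\<Phi> B * X)) = Y * (\<Phi> A * \<Phi> B * X)"
        unfolding prod[OF \<Phi>c[OF AB(1)] \<Phi>c[OF AB(2)] \<Phi>Q[OF AB(2)]]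
        using AB dims2 \<Phi>d by (simp add: mat_assoc)
      then show "(Y * (\<Phi> A * X)) * (Y * (\<Phi> B * X)) = 0\<^sub>m k' k'"
        unfolding z using dims2 by (simp add: mat_zero_mult mat_mult_zero)
    qed
    show "\<forall>A\<in>carrier_mat n n. \<Phi> A = S * block_diag (kron_mat R1 A) (Y * (\<Phi> A * X)) * T"
      by (intro ballI form)
    show "\<forall>A\<in>carrier_mat n n. nilpotent_mat (Y * (\<Phi> A * X))"
      by (intro ballI nil)
    show "S \<in> carrier_mat r r" "T \<in> carrier_mat r r"
      using Sc Tc rk(1) by (simp_all add: mult.commute)
  qed (fact rk(3) R1 R1inv)+
  show ?thesis
  proof (rule that[OF ST _ _ _ sf])
    show "T * S = 1\<^sub>m r" using TS rk by (simp add: mult.commute)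
    show "b \<longrightarrow> T = star \<sigma> S"
      using sT1 sY by (simp add: S_def T_def star_hcat[OF S1 X])
    show "b \<longrightarrow> star \<sigma> R1 = R1"
      using sV sW dims2 by (auto simp: R1_def star_mult mat_assoc)
    show "X \<in> carrier_mat r (r - n * k)" "Y \<in> carrier_mat (r - n * k) r" "b \<longrightarrow> Y = star \<sigma> X"
      using X Y sY rk by simp_all
    show "\<Phi> (1\<^sub>m n) ^\<^sub>m m * X = 0\<^sub>m r (r - n * k)"
      using WmX rk by (simp add: W_def)
    show "(Y * (\<Phi> A * X)) * (Y * (\<Phi> B * X)) = Y * (\<Phi> A * (\<Phi> B * X))"
      if "A \<in> carrier_mat n n" "B \<in> carrier_mat n n" for A B
      by (rule prod[OF \<Phi>c[OF that(1)] \<Phi>c[OF that(2)] \<Phi>Q[OF that(2)]])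
  qed
qed

end

subsection \<open>Concrete involutions\<close>

lemma smult_smult_mat: "a \<cdot>\<^sub>m (c \<cdot>\<^sub>m A) = (a * c) \<cdot>\<^sub>m (A :: 'a::semigroup_mult mat)"
  by (rule eq_matI) (auto simp: mult.assoc)

lemma one_smult_mat: "1 \<cdot>\<^sub>m A = (A :: 'a::monoid_mult mat)"
  by (rule eq_matI) auto

lemma idempotent_nilpotent_zero:
  assumes M: "M \<in> carrier_mat r r" "M * M = M" and nil: "nilpotent_mat M"
  shows "M = 0\<^sub>m r r"
proof -
  obtain m where m: "M ^\<^sub>m m = 0\<^sub>m r r" using nil M by (auto simp: nilpotent_mat_def)
  have "M ^\<^sub>m Suc j = M" for j
    by (induction j) (use M in \<open>simp_all\<close>)
  then have "M = M ^\<^sub>m m * M" by (metis pow_mat.simps(2))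
  then show ?thesis unfolding m using M by (simp add: mat_zero_mult)
qed

text \<open>Only values on \<open>n\<close> by \<open>n\<close> matrices enter
  \<open>star_form\<close>, so a \<open>\<Phi>0\<close> vanishing there can be exchanged for the
  constant zero map.\<close>

lemma star_form_zero:
  assumes sf: "star_form n r \<Phi> k S T R1 \<Phi>0"
    and z: "\<And>A. A \<in> carrier_mat n n \<Longrightarrow> \<Phi>0 A = 0\<^sub>m (r - n * k) (r - n * k)"
  shows "star_form n r \<Phi> k S T R1 (\<lambda>A. 0\<^sub>m (r - n * k) (r - n * k))"
proof -
  let ?z = "0\<^sub>m (r - n * k) (r - n * k) :: 'a mat"
  have "linear_mat_map n (r - n * k) (\<lambda>A. ?z)"
    by (simp add: linear_mat_map_def)
  moreover have "zero_product_preserving n (r - n * k) (\<lambda>A. ?z)"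
    by (simp add: zero_product_preserving_def)
  moreover have "nilpotent_mat ?z"
    unfolding nilpotent_mat_def by (rule exI[of _ 1]) simp
  ultimately show ?thesis
    using sf unfolding star_form_def by (metis z)
qed

text \<open>At a nonzero entry \<open>P_ij\<close> let \<open>y\<close> be row \<open>i\<close> and
  \<open>x\<close> be column \<open>j\<close> divided by \<open>P_ij\<close>; then
  \<open>y x = (P P)_ij / P_ij = 1\<close>.\<close>

lemma normalized_vector_unstructured:
  fixes P :: "'a::field mat"
  assumes P: "P \<in> carrier_mat r r" "P * P = P" "P \<noteq> 0\<^sub>m r r"
  shows "\<exists>x y. x \<in> carrier_mat r 1 \<and> y \<in> carrier_mat 1 r \<and> P * x = x \<and> y * P = y \<and> y * x = 1\<^sub>m 1"
proof -
  obtain i j where ij: "i < r" "j < r" "P $$ (i, j) \<noteq> 0"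
    using P by (auto simp: mat_eq_iff)
  have e: "(\<Sum>l<r. P $$ (a, l) * P $$ (l, c)) = P $$ (a, c)" if "a < r" "c < r" for a c
    using mat_mult_entry[of a P c P] P that by auto
  define x where "x = mat r 1 (\<lambda>(a, _). P $$ (a, j) / P $$ (i, j))"
  define y where "y = mat 1 r (\<lambda>(_, a). P $$ (i, a))"
  have "P * x = x"
  proof (rule eq_matI)
    fix a c assume "a < dim_row x" "c < dim_col x"
    then have ac: "a < r" "c = 0" by (auto simp: x_def)
    have "(P * x) $$ (a, c) = (\<Sum>l<r. P $$ (a, l) * (P $$ (l, j) / P $$ (i, j)))"
      using ac P by (subst mat_mult_entry) (auto simp: x_def)
    also have "\<dots> = x $$ (a, c)"
      using ac ij e[of a j] by (simp add: x_def sum_divide_distrib[symmetric])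
    finally show "(P * x) $$ (a, c) = x $$ (a, c)" .
  qed (use P in \<open>auto simp: x_def\<close>)
  moreover have "y * P = y"
  proof (rule eq_matI)
    fix a c assume "a < dim_row y" "c < dim_col y"
    then have ac: "a = 0" "c < r" by (auto simp: y_def)
    have "(y * P) $$ (a, c) = (\<Sum>l<r. P $$ (i, l) * P $$ (l, c))"
      using ac P by (subst mat_mult_entry) (auto simp: y_def)
    then show "(y * P) $$ (a, c) = y $$ (a, c)"
      using ac ij e[of i c] by (simp add: y_def)
  qed (use P in \<open>auto simp: y_def\<close>)
  moreover have "y * x = 1\<^sub>m 1"
  proof (rule eq_matI)
    fix a c assume "a < dim_row (1\<^sub>m 1 :: 'a mat)" "c < dim_col (1\<^sub>m 1 :: 'a mat)"
    then have ac: "a = 0" "c = 0" by auto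
    have "(y * x) $$ (a, c) = (\<Sum>l<r. P $$ (i, l) * (P $$ (l, j) / P $$ (i, j)))"
      using ac by (subst mat_mult_entry) (auto simp: x_def y_def)
    then show "(y * x) $$ (a, c) = 1\<^sub>m 1 $$ (a, c)"
      using ac ij e[of i j] by (simp add: sum_divide_distrib[symmetric])
  qed (auto simp: x_def y_def)
  ultimately show ?thesis
    by (intro exI[of _ x] exI[of _ y]) (auto simp: x_def y_def)
qed

context field_involution
begin

text \<open>Let \<open>u\<close> be the vector with entries \<open>f\<close>. For a self-adjoint
  idempotent, \<open>x = s P u\<close> has
  \<open>star x * x = \<sigma>(s) s (star u * P * u)\<close>, so it suffices to normalize one value
  of the form by a scalar.\<close>

lemma normalized_vector_from_form:
  assumes P: "P \<in> carrier_mat r r" "P * P = P" "star \<sigma> P = P"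
    and s: "\<sigma> s * s * (\<Sum>a<r. \<Sum>c<r. \<sigma> (f a) * P $$ (a, c) * f c) = 1"
  shows "\<exists>x y. x \<in> carrier_mat r 1 \<and> y \<in> carrier_mat 1 r \<and> P * x = x \<and> y * P = y \<and> y * x = 1\<^sub>m 1 \<and>
    y = star \<sigma> x"
proof -
  define u where "u = mat r 1 (\<lambda>(a, _). f a)"
  define x where "x = s \<cdot>\<^sub>m (P * u)"
  have d: "dim_row u = r" "dim_col u = 1" "dim_row P = r" "dim_col P = r" "dim_row x = r" "dim_col x = 1"
    using P by (auto simp: u_def x_def)
  have PPu: "P * (P * u) = P * u"
    using P d mat_assoc[of P P u] by simp
  have Px: "P * x = x"
    using d PPu by (simp add: x_def mat_smultr)
  have "star \<sigma> x * P = star \<sigma> (P * x)"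
    using d P(3) by (simp add: star_mult)
  then have yP: "star \<sigma> x * P = star \<sigma> x" using Px by simp
  have entry: "(star \<sigma> u * (P * u)) $$ (0, 0) = (\<Sum>a<r. \<Sum>c<r. \<sigma> (f a) * P $$ (a, c) * f c)"
  proof -
    have "(star \<sigma> u * (P * u)) $$ (0, 0) = (\<Sum>a<r. star \<sigma> u $$ (0, a) * (P * u) $$ (a, 0))"
      using d by (subst mat_mult_entry) auto
    also have "\<dots> = (\<Sum>a<r. \<sigma> (f a) * (\<Sum>c<r. P $$ (a, c) * f c))"
    proof (rule sum.cong[OF refl])
      fix a assume "a \<in> {..<r}"
      then show "star \<sigma> u $$ (0, a) * (P * u) $$ (a, 0) = \<sigma> (f a) * (\<Sum>c<r. P $$ (a, c) * f c)"
        using d by (subst mat_mult_entry) (auto simp: u_def star_def)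
    qed
    finally show ?thesis by (simp add: sum_distrib_left mult.assoc)
  qed
  have "star \<sigma> x * x = (\<sigma> s * s) \<cdot>\<^sub>m (star \<sigma> u * (P * u))"
    using d P(3) PPu by (simp add: x_def star_smult star_mult mat_smultl mat_smultr mat_assoc smult_smult_mat mult.commute)
  also have "\<dots> = 1\<^sub>m 1"
  proof (rule eq_matI)
    fix a c assume "a < dim_row (1\<^sub>m 1 :: 'a mat)" "c < dim_col (1\<^sub>m 1 :: 'a mat)"
    then have "a = 0" "c = 0" by auto
    then show "((\<sigma> s * s) \<cdot>\<^sub>m (star \<sigma> u * (P * u))) $$ (a, c) = 1\<^sub>m 1 $$ (a, c)"
      using d s entry by (simp del: index_mult_mat(1))
  qed (use d in auto)
  finally have "star \<sigma> x * x = 1\<^sub>m 1" .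
  with Px yP show ?thesis
    using d by (intro exI[of _ x] exI[of _ "star \<sigma> x"]) (auto intro!: carrier_matI)
qed

lemma form_unit_vector:
  assumes "i < r"
  shows "(\<Sum>a<r. \<Sum>c<r. \<sigma> (of_bool (a = i)) * P $$ (a, c) * of_bool (c = i)) = P $$ (i, i)"
proof -
  have "(\<Sum>c<r. \<sigma> (of_bool (a = i)) * P $$ (a, c) * of_bool (c = i)) = (if a = i then P $$ (i, i) else 0)" for a
    using assms
    by (simp add: of_bool_def sigma_zero sigma_one if_distrib[of "\<lambda>x. _ * x"] sum.delta cong: if_cong)
  then show ?thesis using assms by (simp add: sum.delta)
qed

text \<open>The diagonal entry \<open>P_ii\<close> of a self-adjoint idempotent is the square sum of
  row \<open>i\<close>. If that row has a nonzero entry, the projection of the basis vector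
  \<open>e_i\<close> can therefore be normalized.\<close>

lemma mat_duality_definite:
  assumes real: "\<And>r (f :: nat \<Rightarrow> 'a) l. l < r \<Longrightarrow> f l \<noteq> 0 \<Longrightarrow> \<exists>s. \<sigma> s * s * (\<Sum>l<r. f l * \<sigma> (f l)) = 1"
  shows "mat_duality \<sigma> True"
proof
  fix P :: "'a mat" and r
  assume P: "P \<in> carrier_mat r r" "P * P = P" "P \<noteq> 0\<^sub>m r r" "True \<longrightarrow> star \<sigma> P = P"
  obtain i j where ij: "i < r" "j < r" "P $$ (i, j) \<noteq> 0"
    using P by (auto simp: mat_eq_iff)
  have "P $$ (i, i) = (\<Sum>l<r. P $$ (i, l) * P $$ (l, i))"
    using mat_mult_entry[of i P i P] P ij by auto
  also have "\<dots> = (\<Sum>l<r. P $$ (i, l) * \<sigma> (P $$ (i, l)))"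
  proof (rule sum.cong[OF refl])
    fix l assume "l \<in> {..<r}"
    then have "star \<sigma> P $$ (l, i) = \<sigma> (P $$ (i, l))"
      using P(1) ij by (intro star_entry) auto
    then show "P $$ (i, l) * P $$ (l, i) = P $$ (i, l) * \<sigma> (P $$ (i, l))"
      using P(4) by simp
  qed
  finally obtain s where "\<sigma> s * s * P $$ (i, i) = 1"
    using real[of j r "\<lambda>l. P $$ (i, l)"] ij by auto
  then show "\<exists>x y. x \<in> carrier_mat r 1 \<and> y \<in> carrier_mat 1 r \<and> P * x = x \<and> y * P = y \<and> y * x = 1\<^sub>m 1 \<and>
      (True \<longrightarrow> y = star \<sigma> x)"
    using normalized_vector_from_form[of P r s "\<lambda>a. of_bool (a = i)"] P form_unit_vector[OF ij(1)] by simp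
qed

text \<open>The diagonal entries of \<open>star M * M\<close> are the square sums of the columns of
  \<open>M\<close>.\<close>

lemma star_definite_mult_zero:
  assumes definite: "\<forall>r (f :: nat \<Rightarrow> 'a). (\<Sum>l<r. f l * \<sigma> (f l)) = 0 \<longrightarrow> (\<forall>l<r. f l = 0)"
    and M: "M \<in> carrier_mat r c" "star \<sigma> M * M = 0\<^sub>m c c"
  shows "M = 0\<^sub>m r c"
proof (rule eq_matI)
  fix i j assume "i < dim_row (0\<^sub>m r c :: 'a mat)" "j < dim_col (0\<^sub>m r c :: 'a mat)"
  then have ij: "i < r" "j < c" by auto
  have "(\<Sum>l<r. M $$ (l, j) * \<sigma> (M $$ (l, j))) = (star \<sigma> M * M) $$ (j, j)"
    using M(1) ij by (subst mat_mult_entry) (auto simp: star_entry mult.commute)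
  then have "(\<Sum>l<r. M $$ (l, j) * \<sigma> (M $$ (l, j))) = 0"
    unfolding M(2) using ij by simp
  then have "\<forall>l<r. M $$ (l, j) = 0"
    by (rule definite[THEN spec, THEN spec, THEN mp])
  then show "M $$ (i, j) = 0\<^sub>m r c $$ (i, j)"
    using ij by simp
qed (use M in auto)

text \<open>The exponent can be lowered step by step: for \<open>m \<ge> 1\<close> and
  \<open>M = W^m X\<close> one has \<open>star M * M = star X * W^(m-1) * W^(m+1) X\<close>, so
  definiteness turns \<open>W^(m+1) X = 0\<close> into \<open>M = 0\<close>.\<close>

lemma selfadjoint_pow_mult_zero:
  assumes definite: "\<forall>r (f :: nat \<Rightarrow> 'a). (\<Sum>l<r. f l * \<sigma> (f l)) = 0 \<longrightarrow> (\<forall>l<r. f l = 0)"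
    and W: "W \<in> carrier_mat r r" "star \<sigma> W = W" and X: "X \<in> carrier_mat r c"
    and "W ^\<^sub>m m * X = 0\<^sub>m r c"
  shows "W * X = 0\<^sub>m r c"
  using assms(5)
proof (induction m)
  case 0
  then have "X = 0\<^sub>m r c" using W X by simp
  then show ?case using W by simp
next
  case (Suc m)
  show ?case
  proof (cases m)
    case 0
    then show ?thesis using Suc.prems W by simp
  next
    case (Suc j)
    let ?M = "W ^\<^sub>m m * X"
    have d: "dim_row W = r" "dim_col W = r" "dim_row X = r" "dim_col X = c"
      "dim_row (W ^\<^sub>m i) = r" "dim_col (W ^\<^sub>m i) = r" for i
      using W X pow_mat_dim_square[OF W(1)] by auto
    have "star \<sigma> ?M * ?M = star \<sigma> X * (W ^\<^sub>m m * W ^\<^sub>m m * X)"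
      using d star_pow[OF W] by (simp add: star_mult mat_assoc)
    also have "W ^\<^sub>m m * W ^\<^sub>m m = W ^\<^sub>m j * W ^\<^sub>m Suc m"
      unfolding pow_mat_plus[OF W(1), symmetric] Suc by simp
    also have "star \<sigma> X * (W ^\<^sub>m j * W ^\<^sub>m Suc m * X) = star \<sigma> X * (W ^\<^sub>m j * (W ^\<^sub>m Suc m * X))"
      using d by (simp add: mat_assoc del: pow_mat.simps)
    also have "\<dots> = 0\<^sub>m c c"
      unfolding Suc.prems using d by (simp add: mat_mult_zero)
    finally have "?M = 0\<^sub>m r c"
      by (rule star_definite_mult_zero[OF definite, rotated]) (rule carrier_matI; simp add: d)
    then show ?thesis by (rule Suc.IH)
  qed
qed

end

text \<open>For \<open>z w = 1\<close> this is the rank one idempotent \<open>(E_ii + w E_ij + z E_ji + E_jj) / 2\<close>.\<close>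

definition half_proj :: "nat \<Rightarrow> nat \<Rightarrow> nat \<Rightarrow> 'a::field \<Rightarrow> 'a \<Rightarrow> 'a mat" where
  "half_proj n i j z w = outer_mat n (\<lambda>l. (of_bool (l = i) + z * of_bool (l = j)) / 2)
     (\<lambda>l. of_bool (l = i) + w * of_bool (l = j))"

context
  fixes n i j :: nat and z w :: "'a::field"
  assumes two: "(2 :: 'a) \<noteq> 0" and ij: "i < n" "j < n" "i \<noteq> j" and zw: "z * w = 1"
begin

lemma half_proj_sum:
  "(\<Sum>l<n. (of_bool (l = i) + w * of_bool (l = j)) * ((of_bool (l = i) + z * of_bool (l = j)) / 2)) = 1"
proof -
  have "(\<Sum>l<n. (of_bool (l = i) + w * of_bool (l = j)) * ((of_bool (l = i) + z * of_bool (l = j)) / 2))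
      = (\<Sum>l<n. (if l = i then 1 / 2 else 0) + (if l = j then 1 / 2 else 0))"
    using ij zw by (intro sum.cong) (auto simp: mult.commute)
  also have "\<dots> = 1 / 2 + 1 / 2"
    using ij by (simp add: sum.distrib sum.delta)
  finally show ?thesis using two by (simp add: field_simps)
qed

lemma half_proj_props:
  shows "half_proj n i j z w \<in> carrier_mat n n" and "mat_rank (half_proj n i j z w) = 1"
    and "half_proj n i j z w * half_proj n i j z w = half_proj n i j z w"
  using mat_rank_outer[OF half_proj_sum] outer_mat_idem[OF half_proj_sum]
  by (simp_all add: half_proj_def)

lemma half_proj_expand:
  "2 \<cdot>\<^sub>m half_proj n i j z w - unit_mat n i i - unit_mat n j j = w \<cdot>\<^sub>m unit_mat n i j + z \<cdot>\<^sub>m unit_mat n j i"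
  using two ij zw by (intro eq_matI) (auto simp: half_proj_def outer_mat_def unit_mat_def)

text \<open>Values on idempotents control this combination of the off-diagonal units; varying
  \<open>z\<close> can separate the two units.\<close>

lemma half_proj_image:
  assumes lin: "linear_mat_map n r \<Phi>"
  shows "w \<cdot>\<^sub>m \<Phi> (unit_mat n i j) + z \<cdot>\<^sub>m \<Phi> (unit_mat n j i) =
    2 \<cdot>\<^sub>m \<Phi> (half_proj n i j z w) - \<Phi> (unit_mat n i i) - \<Phi> (unit_mat n j j)"
proof -
  have "\<Phi> (w \<cdot>\<^sub>m unit_mat n i j + z \<cdot>\<^sub>m unit_mat n j i) =
      2 \<cdot>\<^sub>m \<Phi> (half_proj n i j z w) - \<Phi> (unit_mat n i i) - \<Phi> (unit_mat n j j)"
    unfolding half_proj_expand[symmetric] using half_proj_props(1)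
    by (simp add: linear_mat_map_diff[OF lin] linear_mat_mapD(3)[OF lin] minus_carrier_mat)
  then show ?thesis by (simp add: linear_mat_mapD(2,3)[OF lin])
qed

end

lemma unit_mat_proj:
  fixes i :: nat
  assumes "i < n"
  shows "mat_rank (unit_mat n i i :: 'a::field mat) = 1" "unit_mat n i i * unit_mat n i i = (unit_mat n i i :: 'a mat)"
proof -
  have "(\<Sum>l<n. of_bool (l = i) * of_bool (l = i)) = (1 :: 'a)"
    using assms by (simp add: of_bool_def if_distrib[of "\<lambda>x. x * _"] sum.delta cong: if_cong)
  then show "mat_rank (unit_mat n i i :: 'a mat) = 1" "unit_mat n i i * unit_mat n i i = (unit_mat n i i :: 'a mat)"
    unfolding outer_unit by (rule mat_rank_outer, rule outer_mat_idem)
qed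

section \<open>Maps with self-adjoint values on projections\<close>

context mat_duality
begin

text \<open>The off-diagonal hypothesis of \<open>zpp_structure\<close> follows from
  \<open>E_0i + E_i0 = 2 H - E_00 - E_ii\<close> with \<open>H\<close> the half projection, because
  \<open>\<sigma>\<close> fixes 2.\<close>

lemma zpp_structure_selfadjoint:
  assumes b: b and two: "(2 :: 'a) \<noteq> 0"
    and lin: "linear_mat_map n r \<Phi>" and zpp: "zero_product_preserving n r \<Phi>"
    and unit: "\<And>i. i < n \<Longrightarrow> star \<sigma> (\<Phi> (unit_mat n i i)) = \<Phi> (unit_mat n i i)"
    and half: "\<And>i j. i < n \<Longrightarrow> j < n \<Longrightarrow> i \<noteq> j \<Longrightarrow>
      star \<sigma> (\<Phi> (half_proj n i j 1 1)) = \<Phi> (half_proj n i j 1 1)"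
  obtains k S R1 X m where
    "S * star \<sigma> S = 1\<^sub>m r" "star \<sigma> S * S = 1\<^sub>m r" "star \<sigma> R1 = R1"
    "star_form n r \<Phi> k S (star \<sigma> S) R1 (\<lambda>A. star \<sigma> X * (\<Phi> A * X))"
    "X \<in> carrier_mat r (r - n * k)" "\<Phi> (1\<^sub>m n) ^\<^sub>m m * X = 0\<^sub>m r (r - n * k)"
    "\<And>A B. A \<in> carrier_mat n n \<Longrightarrow> B \<in> carrier_mat n n \<Longrightarrow>
      (star \<sigma> X * (\<Phi> A * X)) * (star \<sigma> X * (\<Phi> B * X)) = star \<sigma> X * (\<Phi> A * (\<Phi> B * X))"
proof -
  have off: "star \<sigma> (\<Phi> (unit_mat n 0 i + unit_mat n i 0)) = \<Phi> (unit_mat n 0 i + unit_mat n i 0)"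
    if i: "0 < i" "i < n" for i
  proof -
    have n: "0 < n" "0 \<noteq> i" using i by auto
    have s2: "\<sigma> 2 = 2" using sigma_add[of 1 1] by (simp add: sigma_one)
    note c = linear_mat_mapD(1)[OF lin half_proj_props(1)[OF two n(1) i(2) n(2), of 1 1, simplified]]
      linear_mat_mapD(1)[OF lin unit_mat_carrier[of n 0 0]] linear_mat_mapD(1)[OF lin unit_mat_carrier[of n i i]]
    have "\<Phi> (unit_mat n 0 i + unit_mat n i 0) =
        2 \<cdot>\<^sub>m \<Phi> (half_proj n 0 i 1 1) - \<Phi> (unit_mat n 0 0) - \<Phi> (unit_mat n i i)"
      using half_proj_image[OF two n(1) i(2) n(2) _ lin, of 1 1]
        by (simp add: linear_mat_mapD(2)[OF lin] one_smult_mat)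
    then show ?thesis
      using half[OF n(1) i(2) n(2)] unit[OF n(1)] unit[OF i(2)] c[THEN carrier_matD(1)] c[THEN carrier_matD(2)]
      by (simp add: star_diff star_smult s2)
  qed
  show ?thesis
  proof (rule zpp_structure[OF lin zpp unit off])
    fix k S T R1 X Y m
    assume "S * T = 1\<^sub>m r" "T * S = 1\<^sub>m r" "b \<longrightarrow> T = star \<sigma> S" "b \<longrightarrow> star \<sigma> R1 = R1"
      "star_form n r \<Phi> k S T R1 (\<lambda>A. Y * (\<Phi> A * X))"
      "X \<in> carrier_mat r (r - n * k)" "b \<longrightarrow> Y = star \<sigma> X" "\<Phi> (1\<^sub>m n) ^\<^sub>m m * X = 0\<^sub>m r (r - n * k)"
      "\<And>A B. A \<in> carrier_mat n n \<Longrightarrow> B \<in> carrier_mat n n \<Longrightarrow>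
        (Y * (\<Phi> A * X)) * (Y * (\<Phi> B * X)) = Y * (\<Phi> A * (\<Phi> B * X))"
    with b show ?thesis by (intro that[of S R1 k X m]) simp_all
  qed
qed

text \<open>How far the last conclusion determines \<open>\<Phi>0\<close> depends on
  \<open>\<sigma>\<close>: the rank one projections span all matrices for \<open>cnj\<close>, but
  only the symmetric ones for the real transpose.\<close>

lemma zpp_structure_definite:
  assumes b: b and two: "(2 :: 'a) \<noteq> 0"
    and definite: "\<forall>r (f :: nat \<Rightarrow> 'a). (\<Sum>l<r. f l * \<sigma> (f l)) = 0 \<longrightarrow> (\<forall>l<r. f l = 0)"
    and lin: "linear_mat_map n r \<Phi>" and zpp: "zero_product_preserving n r \<Phi>"
    and proj: "\<And>A. A \<in> carrier_mat n n \<Longrightarrow> mat_rank A = 1 \<Longrightarrow> A * A = A \<Longrightarrow> star \<sigma> A = A \<Longrightarrow>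
      star \<sigma> (\<Phi> A) = \<Phi> A"
  obtains k S R1 \<Phi>0 where
    "S * star \<sigma> S = 1\<^sub>m r" "star \<sigma> S * S = 1\<^sub>m r" "star \<sigma> R1 = R1"
    "star_form n r \<Phi> k S (star \<sigma> S) R1 \<Phi>0"
    "\<And>A B. A \<in> carrier_mat n n \<Longrightarrow> B \<in> carrier_mat n n \<Longrightarrow> \<Phi>0 A * \<Phi>0 B = 0\<^sub>m (r - n * k) (r - n * k)"
    "\<And>A. A \<in> carrier_mat n n \<Longrightarrow> mat_rank A = 1 \<Longrightarrow> A * A = A \<Longrightarrow> star \<sigma> A = A \<Longrightarrow>
      \<Phi>0 A = 0\<^sub>m (r - n * k) (r - n * k)"
proof -
  have unit: "star \<sigma> (\<Phi> (unit_mat n i i)) = \<Phi> (unit_mat n i i)" if "i < n" for i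
    by (rule proj[OF unit_mat_carrier unit_mat_proj[OF that]])
      (auto simp: unit_mat_def star_def sigma_zero sigma_one intro!: eq_matI)
  \<comment> \<open>\<open>\<sigma>\<close> fixes 2 and hence \<open>1 / 2\<close>, so the half
    projections with \<open>z = w = 1\<close> are self-adjoint.\<close>
  have s2: "\<sigma> 2 = 2" using sigma_add[of 1 1] by (simp add: sigma_one)
  have "\<sigma> (inverse 2) * 2 = 1"
    using sigma_mult[of "inverse 2" 2] two s2 by (simp add: sigma_one)
  then have sh: "\<sigma> (1 / 2) = 1 / 2" using two by (simp add: field_simps)
  have half: "star \<sigma> (\<Phi> (half_proj n i j 1 1)) = \<Phi> (half_proj n i j 1 1)" if "i < n" "j < n" "i \<noteq> j" for i j
    using that by (intro proj half_proj_props[OF two])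
      (auto simp: half_proj_def outer_mat_def star_def sh sigma_zero sigma_one intro!: eq_matI)
  note W = linear_mat_mapD(1)[OF lin one_carrier_mat]
  have sW: "star \<sigma> (\<Phi> (1\<^sub>m n)) = \<Phi> (1\<^sub>m n)"
    by (rule star_image_one[OF lin unit])
  obtain k S R1 X m where S: "S * star \<sigma> S = 1\<^sub>m r" "star \<sigma> S * S = 1\<^sub>m r" "star \<sigma> R1 = R1"
    and sf: "star_form n r \<Phi> k S (star \<sigma> S) R1 (\<lambda>A. star \<sigma> X * (\<Phi> A * X))"
    and X: "X \<in> carrier_mat r (r - n * k)" "\<Phi> (1\<^sub>m n) ^\<^sub>m m * X = 0\<^sub>m r (r - n * k)"
    and prod: "\<And>A B. A \<in> carrier_mat n n \<Longrightarrow> B \<in> carrier_mat n n \<Longrightarrow>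
      (star \<sigma> X * (\<Phi> A * X)) * (star \<sigma> X * (\<Phi> B * X)) = star \<sigma> X * (\<Phi> A * (\<Phi> B * X))"
    by (rule zpp_structure_selfadjoint[OF b two lin zpp unit half], assumption+, rule that)
  have WX: "\<Phi> (1\<^sub>m n) * X = 0\<^sub>m r (r - n * k)"
    by (rule selfadjoint_pow_mult_zero[OF definite W sW X])
  define \<Phi>0 where "\<Phi>0 A = star \<sigma> X * (\<Phi> A * X)" for A
  have mult: "\<Phi>0 A * \<Phi>0 B = 0\<^sub>m (r - n * k) (r - n * k)" if "A \<in> carrier_mat n n" "B \<in> carrier_mat n n" for A B
  proof -
    have AB: "A * B \<in> carrier_mat n n" using that by simp
    note d = carrier_matD[OF linear_mat_mapD(1)[OF lin that(1)]] carrier_matD[OF linear_mat_mapD(1)[OF lin that(2)]]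
      carrier_matD[OF linear_mat_mapD(1)[OF lin AB]] carrier_matD[OF W] carrier_matD[OF X(1)]
    have "\<Phi>0 A * \<Phi>0 B = star \<sigma> X * (\<Phi> A * \<Phi> B * X)"
      unfolding \<Phi>0_def prod[OF that] using d by (simp add: mat_assoc)
    \<comment> \<open>The second form of \<open>zpp_mult\<close> places
      \<open>\<Phi> (1\<^sub>m n)\<close> on the right, next to \<open>X\<close>, where it
      vanishes.\<close>
    also have "\<Phi> A * \<Phi> B * X = \<Phi> (A * B) * (\<Phi> (1\<^sub>m n) * X)"
      unfolding zpp_mult(2)[OF lin zpp that] using d by (simp add: mat_assoc)
    also have "star \<sigma> X * \<dots> = 0\<^sub>m (r - n * k) (r - n * k)"
      unfolding WX using d by (simp add: mat_mult_zero)
    finally show ?thesis .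
  qed
  have zero: "\<Phi>0 A = 0\<^sub>m (r - n * k) (r - n * k)"
    if A: "A \<in> carrier_mat n n" "mat_rank A = 1" "A * A = A" "star \<sigma> A = A" for A
  proof -
    note c = linear_mat_mapD(1)[OF lin A(1)]
    have "star \<sigma> (\<Phi>0 A) = \<Phi>0 A"
      unfolding \<Phi>0_def using proj[OF A] c X(1) by (auto simp: star_mult mat_assoc)
    then have "star \<sigma> (\<Phi>0 A) * \<Phi>0 A = 0\<^sub>m (r - n * k) (r - n * k)"
      using mult[OF A(1) A(1)] by simp
    moreover have "\<Phi>0 A \<in> carrier_mat (r - n * k) (r - n * k)"
      unfolding \<Phi>0_def by (intro mult_carrier_mat[OF star_carrier[OF X(1)]] mult_carrier_mat[OF c X(1)])
    ultimately show ?thesis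
      using star_definite_mult_zero[OF definite] by blast
  qed
  have "star_form n r \<Phi> k S (star \<sigma> S) R1 \<Phi>0"
    using sf unfolding \<Phi>0_def .
  from that[OF S this mult zero] show ?thesis .
qed

end

section \<open>Transpose and conjugate transpose as dualities\<close>

lemma mat_adjoint_eq_star: "mat_adjoint A = star cnj A" for A :: "complex mat"
  by (rule eq_matI) (auto simp: mat_adjoint_def star_def mat_of_rows_index)

lemma transpose_eq_star: "transpose_mat A = star (\<lambda>x. x) A"
  by (rule eq_matI) (auto simp: star_def)

lemma field_involution_id: "field_involution (\<lambda>x :: 'a::field. x)"
  by unfold_locales simp_all

lemma field_involution_cnj: "field_involution cnj"
  by unfold_locales simp_all

lemma mat_duality_trivial: "mat_duality (\<lambda>x :: 'a::field. x) False"
proof -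
  interpret field_involution "\<lambda>x :: 'a. x" by (rule field_involution_id)
  show ?thesis
    by unfold_locales (use normalized_vector_unstructured in blast)
qed

lemma sum_norm_square_pos:
  fixes f :: "nat \<Rightarrow> 'a::real_normed_vector"
  assumes "l < r" "f l \<noteq> 0"
  shows "(\<Sum>l<r. (norm (f l))\<^sup>2) > 0"
  using assms by (intro sum_pos2[of _ l]) auto

lemma sum_mult_self_pos:
  fixes f :: "nat \<Rightarrow> real"
  assumes "l < r" "f l \<noteq> 0"
  shows "(\<Sum>l<r. f l * f l) > 0"
  using sum_norm_square_pos[of l r f] assms by (simp add: power2_eq_square)

lemma sum_mult_cnj: "(\<Sum>l<r. f l * cnj (f l)) = of_real (\<Sum>l<r. (norm (f l))\<^sup>2)"
  by (simp only: of_real_sum complex_norm_square)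

lemma inverse_sqrt_square: "t > 0 \<Longrightarrow> 1 / sqrt t * (1 / sqrt t) * t = 1"
  by simp

lemma inverse_csqrt_square: "q \<noteq> 0 \<Longrightarrow> 1 / csqrt q * (1 / csqrt q) * q = 1"
  using power2_csqrt[of q] by (simp add: power2_eq_square)

lemma mat_duality_cnj: "mat_duality cnj True"
proof -
  interpret field_involution cnj by (rule field_involution_cnj)
  show ?thesis
  proof (rule mat_duality_definite)
    fix r l and f :: "nat \<Rightarrow> complex"
    assume "l < r" "f l \<noteq> 0"
    define t where "t = (\<Sum>l<r. (norm (f l))\<^sup>2)"
    have t: "t > 0" unfolding t_def by (rule sum_norm_square_pos) fact+
    \<comment> \<open>A real scalar, hence unchanged by \<open>cnj\<close>.\<close>
    let ?s = "of_real (1 / sqrt t) :: complex"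
    have "cnj ?s * ?s * of_real t = of_real (1 / sqrt t * (1 / sqrt t) * t)"
      by (simp only: complex_cnj_complex_of_real of_real_mult)
    also have "\<dots> = 1" using inverse_sqrt_square[OF t] by simp
    finally show "\<exists>s. cnj s * s * (\<Sum>l<r. f l * cnj (f l)) = 1"
      unfolding sum_mult_cnj t_def by blast
  qed
qed

lemma mat_duality_real: "mat_duality (\<lambda>x :: real. x) True"
proof -
  interpret field_involution "\<lambda>x :: real. x" by (rule field_involution_id)
  show ?thesis
  proof (rule mat_duality_definite)
    fix r l and f :: "nat \<Rightarrow> real"
    assume "l < r" "f l \<noteq> 0"
    define t where "t = (\<Sum>l<r. f l * f l)"
    have t: "t > 0" unfolding t_def
      using sum_mult_self_pos[of l r f] \<open>l < r\<close> \<open>f l \<noteq> 0\<close> by blast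
    have "1 / sqrt t * (1 / sqrt t) * t = 1"
      by (rule inverse_sqrt_square[OF t])
    then show "\<exists>s. s * s * (\<Sum>l<r. f l * f l) = 1"
      unfolding t_def by (rule exI[of _ "1 / sqrt (\<Sum>l<r. f l * f l)"])
  qed
qed

text \<open>Here the form may have isotropic vectors, so a basis vector need not work; but a symmetric matrix with
  zero diagonal and nonzero \<open>(i, j)\<close> entry takes the value \<open>2 P_ij\<close> at \<open>e_i + e_j\<close>.\<close>

lemma mat_duality_complex_transpose: "mat_duality (\<lambda>x :: complex. x) True"
proof -
  interpret field_involution "\<lambda>x :: complex. x" by (rule field_involution_id)
  show ?thesis
  proof
    fix P :: "complex mat" and r
    assume P: "P \<in> carrier_mat r r" "P * P = P" "P \<noteq> 0\<^sub>m r r" "True \<longrightarrow> star (\<lambda>x. x) P = P"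
    obtain i j where ij: "i < r" "j < r" "P $$ (i, j) \<noteq> 0"
      using P by (auto simp: mat_eq_iff)
    have "\<exists>f. (\<Sum>a<r. \<Sum>c<r. f a * P $$ (a, c) * f c) \<noteq> 0"
    proof (cases "P $$ (i, i) = 0 \<and> P $$ (j, j) = 0")
      case True
      have sym: "P $$ (j, i) = P $$ (i, j)"
        using P ij star_entry[of j P i "\<lambda>x. x"] by auto
      have e: "(\<Sum>c<r. (of_bool (a = i) + of_bool (a = j)) * P $$ (a, c) * (of_bool (c = i) + of_bool (c = j)))
          = (of_bool (a = i) + of_bool (a = j)) * (P $$ (a, i) + P $$ (a, j))" for a
        using ij by (simp add: distrib_left sum.distrib of_bool_def if_distrib[of "\<lambda>x. _ * x"] sum.delta cong: if_cong)
      have "(\<Sum>a<r. \<Sum>c<r. (of_bool (a = i) + of_bool (a = j)) * P $$ (a, c) * (of_bool (c = i) + of_bool (c = j)))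
          = (P $$ (i, i) + P $$ (i, j)) + (P $$ (j, i) + P $$ (j, j))"
        unfolding e using ij
        by (simp add: distrib_right sum.distrib of_bool_def if_distrib[of "\<lambda>x. x * _"] sum.delta cong: if_cong)
      also have "\<dots> \<noteq> 0" using True sym ij by simp
      finally show ?thesis by (rule exI[of _ "\<lambda>a. of_bool (a = i) + of_bool (a = j)"])
    next
      case False
      then show ?thesis using form_unit_vector[of i r P] form_unit_vector[of j r P] ij by metis
    qed
    then obtain f where f: "(\<Sum>a<r. \<Sum>c<r. f a * P $$ (a, c) * f c) \<noteq> 0" (is "?q \<noteq> 0") by blast
    \<comment> \<open>Every nonzero value of the form can be normalized, since it has a complex
      square root.\<close>
    have "1 / csqrt ?q * (1 / csqrt ?q) * ?q = 1"
      by (rule inverse_csqrt_square[OF f])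
    then show "\<exists>x y. x \<in> carrier_mat r 1 \<and> y \<in> carrier_mat 1 r \<and> P * x = x \<and> y * P = y \<and> y * x = 1\<^sub>m 1 \<and>
        (True \<longrightarrow> y = star (\<lambda>x. x) x)"
      using normalized_vector_from_form[of P r "1 / csqrt ?q" f] P by simp
  qed
qed

section \<open>From the structure lemma to the general form and the special cases\<close>

lemma zpp_general:
  fixes \<Phi> :: "'a::field mat \<Rightarrow> 'a mat"
  assumes lin: "linear_mat_map n r \<Phi>" and zpp: "zero_product_preserving n r \<Phi>"
  shows "\<exists>k S T R1 \<Phi>0. S * T = 1\<^sub>m r \<and> T * S = 1\<^sub>m r \<and> star_form n r \<Phi> k S T R1 \<Phi>0"
    and "(\<And>A. A \<in> carrier_mat n n \<Longrightarrow> mat_rank A = 1 \<Longrightarrow> A * A = A \<Longrightarrow> \<Phi> A * \<Phi> A = \<Phi> A) \<Longrightarrow>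
      \<exists>k S T R1. S * T = 1\<^sub>m r \<and> T * S = 1\<^sub>m r \<and>
        star_form n r \<Phi> k S T R1 (\<lambda>A. 0\<^sub>m (r - n * k) (r - n * k))"
proof -
  interpret mat_duality "\<lambda>x :: 'a. x" False by (rule mat_duality_trivial)
  obtain k S T R1 X Y where ST: "S * T = 1\<^sub>m r" "T * S = 1\<^sub>m r"
    and sf: "star_form n r \<Phi> k S T R1 (\<lambda>A. Y * (\<Phi> A * X))"
    and X: "X \<in> carrier_mat r (r - n * k)" and Y: "Y \<in> carrier_mat (r - n * k) r"
    and prod: "\<And>A B. A \<in> carrier_mat n n \<Longrightarrow> B \<in> carrier_mat n n \<Longrightarrow>
      (Y * (\<Phi> A * X)) * (Y * (\<Phi> B * X)) = Y * (\<Phi> A * (\<Phi> B * X))"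
    by (rule zpp_structure[OF lin zpp]) (blast+)
  show "\<exists>k S T R1 \<Phi>0. S * T = 1\<^sub>m r \<and> T * S = 1\<^sub>m r \<and> star_form n r \<Phi> k S T R1 \<Phi>0"
    using ST sf by blast
  assume idem: "\<And>A. A \<in> carrier_mat n n \<Longrightarrow> mat_rank A = 1 \<Longrightarrow> A * A = A \<Longrightarrow> \<Phi> A * \<Phi> A = \<Phi> A"
  let ?z = "0\<^sub>m (r - n * k) (r - n * k) :: 'a mat"
  have lin0: "linear_mat_map n (r - n * k) (\<lambda>A. Y * (\<Phi> A * X))"
    and nil: "\<And>A. A \<in> carrier_mat n n \<Longrightarrow> nilpotent_mat (Y * (\<Phi> A * X))"
    using sf by (auto simp: star_form_def)
  \<comment> \<open>On a rank one idempotent the nilpotent part takes a value that is idempotent by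
    the product rule, hence zero; such idempotents span.\<close>
  have "Y * (\<Phi> A * X) = ?z" if "A \<in> carrier_mat n n" for A
    using that
  proof (induction rule: mat_rank_one_idem_induct)
    case zero
    then show ?case using linear_mat_map_zero[OF lin0] .
  next
    case (add B C)
    then show ?case using linear_mat_mapD(2)[OF lin0] by simp
  next
    case (smult c B)
    then show ?case using linear_mat_mapD(3)[OF lin0] by simp
  next
    case (idem P)
    note c = linear_mat_mapD(1)[OF lin idem(1)]
    have "(Y * (\<Phi> P * X)) * (Y * (\<Phi> P * X)) = Y * (\<Phi> P * \<Phi> P * X)"
      unfolding prod[OF idem(1) idem(1)] using c X by (auto simp: mat_assoc)
    then have "(Y * (\<Phi> P * X)) * (Y * (\<Phi> P * X)) = Y * (\<Phi> P * X)"
      using \<open>P \<in> carrier_mat n n \<Longrightarrow> mat_rank P = 1 \<Longrightarrow> P * P = P \<Longrightarrow> \<Phi> P * \<Phi> P = \<Phi> P\<close> idem by simp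
    then show ?case
      by (rule idempotent_nilpotent_zero[OF linear_mat_mapD(1)[OF lin0 idem(1)] _ nil[OF idem(1)]])
  qed
  from star_form_zero[OF sf this] ST
  show "\<exists>k S T R1. S * T = 1\<^sub>m r \<and> T * S = 1\<^sub>m r \<and>
      star_form n r \<Phi> k S T R1 (\<lambda>A. 0\<^sub>m (r - n * k) (r - n * k))"
    by blast
qed

text \<open>The remaining point is \<open>\<Phi>0 = 0\<close>. For \<open>z\<close> of modulus 1 the
  half projection with \<open>w = cnj z\<close> is Hermitian, so
  \<open>cnj z \<Phi>0(E_ij) + z \<Phi>0(E_ji) = 0\<close>; the choices \<open>z = 1\<close> and
  \<open>z = \<i>\<close> together force \<open>\<Phi>0(E_ij) = 0\<close>.\<close>

lemma zpp_hermitian: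
  fixes \<Phi> :: "complex mat \<Rightarrow> complex mat"
  assumes lin: "linear_mat_map n r \<Phi>" and zpp: "zero_product_preserving n r \<Phi>"
    and herm: "\<And>A. A \<in> carrier_mat n n \<Longrightarrow> mat_rank A = 1 \<Longrightarrow> A * A = A \<Longrightarrow> mat_adjoint A = A \<Longrightarrow>
      mat_adjoint (\<Phi> A) = \<Phi> A"
  shows "\<exists>k S R1. S * mat_adjoint S = 1\<^sub>m r \<and> mat_adjoint S * S = 1\<^sub>m r \<and> mat_adjoint R1 = R1 \<and>
    star_form n r \<Phi> k S (mat_adjoint S) R1 (\<lambda>A. 0\<^sub>m (r - n * k) (r - n * k))"
proof -
  interpret mat_duality cnj True by (rule mat_duality_cnj)
  have definite: "\<forall>r (f :: nat \<Rightarrow> complex). (\<Sum>l<r. f l * cnj (f l)) = 0 \<longrightarrow> (\<forall>l<r. f l = 0)"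
  proof (intro allI impI)
    fix r l and f :: "nat \<Rightarrow> complex"
    assume 0: "(\<Sum>l<r. f l * cnj (f l)) = 0" and l: "l < r"
    show "f l = 0"
    proof (rule ccontr)
      assume "f l \<noteq> 0"
      from sum_norm_square_pos[of l r f, OF l this] 0 show False
        unfolding sum_mult_cnj of_real_eq_0_iff by simp
    qed
  qed
  obtain k S R1 \<Phi>0 where S: "S * star cnj S = 1\<^sub>m r" "star cnj S * S = 1\<^sub>m r" "star cnj R1 = R1"
    and sf: "star_form n r \<Phi> k S (star cnj S) R1 \<Phi>0"
    and zero: "\<And>A. A \<in> carrier_mat n n \<Longrightarrow> mat_rank A = 1 \<Longrightarrow> A * A = A \<Longrightarrow> star cnj A = A \<Longrightarrow>
      \<Phi>0 A = 0\<^sub>m (r - n * k) (r - n * k)"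
    by (rule zpp_structure_definite[OF TrueI _ definite lin zpp herm[unfolded mat_adjoint_eq_star]])
      (simp, assumption+, rule that)
  let ?z = "0\<^sub>m (r - n * k) (r - n * k) :: complex mat"
  have lin0: "linear_mat_map n (r - n * k) \<Phi>0"
    using sf by (simp add: star_form_def)
  have unit: "\<Phi>0 (unit_mat n i i) = ?z" if "i < n" for i
    by (rule zero[OF unit_mat_carrier unit_mat_proj[OF that]])
      (auto simp: unit_mat_def star_def intro!: eq_matI)
  have half: "cnj z \<cdot>\<^sub>m \<Phi>0 (unit_mat n i j) + z \<cdot>\<^sub>m \<Phi>0 (unit_mat n j i) = ?z"
    if ij: "i < n" "j < n" "i \<noteq> j" and z: "z * cnj z = 1" for i j z
  proof -
    have z': "cnj z * z = 1" using z by (simp add: mult.commute)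
    note h = half_proj_props[OF _ ij z]
    have "\<Phi>0 (half_proj n i j z (cnj z)) = ?z"
      using h z' by (intro zero) (auto simp: half_proj_def outer_mat_def star_def intro!: eq_matI)
    then show ?thesis
      using half_proj_image[OF _ ij z lin0] unit ij by (simp add: minus_r_inv_mat[OF zero_carrier_mat])
  qed
  have "\<Phi>0 A = ?z" if "A \<in> carrier_mat n n" for A
    using that
  proof (induction rule: mat_unit_induct)
    case zero
    then show ?case using linear_mat_map_zero[OF lin0] .
  next
    case (add B C)
    then show ?case using linear_mat_mapD(2)[OF lin0] by simp
  next
    case (smult c B)
    then show ?case using linear_mat_mapD(3)[OF lin0] by simp
  next
    case (unit i j)
    show ?case
    proof (cases "i = j")
      case False
      let ?U = "\<Phi>0 (unit_mat n i j)" and ?V = "\<Phi>0 (unit_mat n j i)"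
      have c: "?U \<in> carrier_mat (r - n * k) (r - n * k)" "?V \<in> carrier_mat (r - n * k) (r - n * k)"
        by (simp_all add: linear_mat_mapD(1)[OF lin0])
      have e: "cnj 1 \<cdot>\<^sub>m ?U + 1 \<cdot>\<^sub>m ?V = ?z" "cnj \<i> \<cdot>\<^sub>m ?U + \<i> \<cdot>\<^sub>m ?V = ?z"
        using half[OF unit False, of 1] half[OF unit False, of \<i>] by simp_all
      show ?thesis
      proof (rule eq_matI)
        fix a d assume "a < dim_row ?z" "d < dim_col ?z"
        then have ad: "a < r - n * k" "d < r - n * k" by auto
        have "?U $$ (a, d) + ?V $$ (a, d) = 0" "cnj \<i> * ?U $$ (a, d) + \<i> * ?V $$ (a, d) = 0"
          using arg_cong[OF e(1), of "\<lambda>M. M $$ (a, d)"] arg_cong[OF e(2), of "\<lambda>M. M $$ (a, d)"] c ad by auto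
        then have "?U $$ (a, d) + ?V $$ (a, d) = 0" "?V $$ (a, d) = ?U $$ (a, d)"
          by (auto simp: add_eq_0_iff)
        then show "?U $$ (a, d) = ?z $$ (a, d)" using ad by simp
      qed (use c in auto)
    qed (use \<open>\<And>i. i < n \<Longrightarrow> \<Phi>0 (unit_mat n i i) = ?z\<close> unit in simp)
  qed
  from star_form_zero[OF sf this] S show ?thesis
    unfolding mat_adjoint_eq_star by blast
qed

text \<open>The half projections with \<open>z = 1\<close> give only
  \<open>\<Phi>0(E_ij) + \<Phi>0(E_ji) = 0\<close>. By linearity \<open>\<Phi>0\<close> changes sign
  under transposition of its argument, so \<open>2 \<Phi>0(A) = 0\<close> for symmetric
  \<open>A\<close>.\<close>

lemma zpp_real_symmetric:
  fixes \<Phi> :: "real mat \<Rightarrow> real mat"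
  assumes lin: "linear_mat_map n r \<Phi>" and zpp: "zero_product_preserving n r \<Phi>"
    and sym: "\<And>A. A \<in> carrier_mat n n \<Longrightarrow> mat_rank A = 1 \<Longrightarrow> A * A = A \<Longrightarrow> transpose_mat A = A \<Longrightarrow>
      transpose_mat (\<Phi> A) = \<Phi> A"
  shows "\<exists>k S R1 \<Phi>0. S * transpose_mat S = 1\<^sub>m r \<and> transpose_mat S * S = 1\<^sub>m r \<and>
    star_form n r \<Phi> k S (transpose_mat S) R1 \<Phi>0 \<and>
    (\<forall>A \<in> carrier_mat n n. transpose_mat A = A \<longrightarrow> \<Phi>0 A = 0\<^sub>m (r - n * k) (r - n * k)) \<and>
    (\<forall>X \<in> carrier_mat n n. \<forall>Y \<in> carrier_mat n n. \<Phi>0 X * \<Phi>0 Y = 0\<^sub>m (r - n * k) (r - n * k))"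
proof -
  interpret mat_duality "\<lambda>x :: real. x" True by (rule mat_duality_real)
  have definite: "\<forall>r (f :: nat \<Rightarrow> real). (\<Sum>l<r. f l * f l) = 0 \<longrightarrow> (\<forall>l<r. f l = 0)"
  proof (intro allI impI)
    fix r l and f :: "nat \<Rightarrow> real"
    assume 0: "(\<Sum>l<r. f l * f l) = 0" and l: "l < r"
    show "f l = 0"
    proof (rule ccontr)
      assume "f l \<noteq> 0"
      from sum_mult_self_pos[of l r f, OF l this] 0 show False by simp
    qed
  qed
  obtain k S R1 \<Phi>0 where S: "S * star (\<lambda>x. x) S = 1\<^sub>m r" "star (\<lambda>x. x) S * S = 1\<^sub>m r"
    and sf: "star_form n r \<Phi> k S (star (\<lambda>x. x) S) R1 \<Phi>0"
    and mult: "\<And>A B. A \<in> carrier_mat n n \<Longrightarrow> B \<in> carrier_mat n n \<Longrightarrow> \<Phi>0 A * \<Phi>0 B = 0\<^sub>m (r - n * k) (r - n * k)"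
    and zero: "\<And>A. A \<in> carrier_mat n n \<Longrightarrow> mat_rank A = 1 \<Longrightarrow> A * A = A \<Longrightarrow> star (\<lambda>x. x) A = A \<Longrightarrow>
      \<Phi>0 A = 0\<^sub>m (r - n * k) (r - n * k)"
    by (rule zpp_structure_definite[OF TrueI _ definite lin zpp sym[unfolded transpose_eq_star]])
      (simp, assumption+, rule that)
  let ?z = "0\<^sub>m (r - n * k) (r - n * k) :: real mat"
  have lin0: "linear_mat_map n (r - n * k) \<Phi>0"
    using sf by (simp add: star_form_def)
  note c0 = linear_mat_mapD(1)[OF lin0]
  have unit: "\<Phi>0 (unit_mat n i i) = ?z" if "i < n" for i
    by (rule zero[OF unit_mat_carrier unit_mat_proj[OF that]])
      (auto simp: unit_mat_def star_def intro!: eq_matI)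
  have half: "\<Phi>0 (unit_mat n i j) + \<Phi>0 (unit_mat n j i) = ?z" if ij: "i < n" "j < n" "i \<noteq> j" for i j
  proof -
    have "\<Phi>0 (half_proj n i j 1 1) = ?z"
      using ij by (intro zero half_proj_props)
        (auto simp: half_proj_def outer_mat_def star_def intro!: eq_matI)
    then show ?thesis
      using half_proj_image[OF _ ij _ lin0, of 1 1] unit ij by (simp add: one_smult_mat minus_r_inv_mat[OF zero_carrier_mat])
  qed
  have skew: "\<Phi>0 A + \<Phi>0 (transpose_mat A) = ?z" if "A \<in> carrier_mat n n" for A
    using that
  proof (induction rule: mat_unit_induct)
    case zero
    then show ?case using linear_mat_map_zero[OF lin0] by simp
  next
    case (add B C)
    have "\<Phi>0 (B + C) + \<Phi>0 (transpose_mat (B + C)) =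
        (\<Phi>0 B + \<Phi>0 (transpose_mat B)) + (\<Phi>0 C + \<Phi>0 (transpose_mat C))"
      using add(1,2) c0[of B] c0[of C] c0[of "transpose_mat B"] c0[of "transpose_mat C"]
      by (auto simp: transpose_add linear_mat_mapD(2)[OF lin0] intro!: eq_matI)
    then show ?case using add by simp
  next
    case (smult c B)
    have "transpose_mat (c \<cdot>\<^sub>m B) = c \<cdot>\<^sub>m transpose_mat B" by (rule eq_matI) auto
    then have "\<Phi>0 (c \<cdot>\<^sub>m B) + \<Phi>0 (transpose_mat (c \<cdot>\<^sub>m B)) = c \<cdot>\<^sub>m (\<Phi>0 B + \<Phi>0 (transpose_mat B))"
      using smult(1) c0[of B] c0[of "transpose_mat B"]
      by (auto simp: linear_mat_mapD(3)[OF lin0] distrib_left intro!: eq_matI)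
    then show ?case using smult by simp
  next
    case (unit i j)
    have "transpose_mat (unit_mat n i j) = (unit_mat n j i :: real mat)"
      by (rule eq_matI) (auto simp: unit_mat_def)
    then show ?case
      using half[OF unit] \<open>\<And>i. i < n \<Longrightarrow> \<Phi>0 (unit_mat n i i) = ?z\<close> unit by (cases "i = j") auto
  qed
  have "\<Phi>0 A = ?z" if A: "A \<in> carrier_mat n n" "transpose_mat A = A" for A
  proof (rule eq_matI)
    fix a d assume "a < dim_row ?z" "d < dim_col ?z"
    then show "\<Phi>0 A $$ (a, d) = ?z $$ (a, d)"
      using arg_cong[OF skew[OF A(1)], of "\<lambda>M. M $$ (a, d)"] A c0[OF A(1)] by auto
  qed (use c0[OF A(1)] in auto)
  with S sf mult show ?thesis
    unfolding transpose_eq_star by blast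
qed

text \<open>The bilinear form \<open>x^t y\<close> on complex vectors has isotropic vectors, so the
  self-adjoint version of the structure lemma is applied rather than the definite one. The matrices
  it tests, diagonal units and half projections with \<open>z = w = 1\<close>, have real
  entries.\<close>

lemma zpp_complex_symmetric:
  fixes \<Phi> :: "complex mat \<Rightarrow> complex mat"
  assumes lin: "linear_mat_map n r \<Phi>" and zpp: "zero_product_preserving n r \<Phi>"
    and sym: "\<And>A. A \<in> carrier_mat n n \<Longrightarrow> \<forall>i<n. \<forall>j<n. A $$ (i, j) \<in> \<real> \<Longrightarrow> mat_rank A = 1 \<Longrightarrow>
      A * A = A \<Longrightarrow> transpose_mat A = A \<Longrightarrow> transpose_mat (\<Phi> A) = \<Phi> A"
  shows "\<exists>k S R1 \<Phi>0. S * transpose_mat S = 1\<^sub>m r \<and> transpose_mat S * S = 1\<^sub>m r \<and>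
    transpose_mat R1 = R1 \<and> star_form n r \<Phi> k S (transpose_mat S) R1 \<Phi>0"
proof -
  interpret mat_duality "\<lambda>x :: complex. x" True by (rule mat_duality_complex_transpose)
  have unit: "star (\<lambda>x. x) (\<Phi> (unit_mat n i i)) = \<Phi> (unit_mat n i i)" if "i < n" for i
    unfolding transpose_eq_star[symmetric]
    by (rule sym[OF unit_mat_carrier _ unit_mat_proj[OF that]])
      (auto simp: unit_mat_def intro!: eq_matI)
  have half: "star (\<lambda>x. x) (\<Phi> (half_proj n i j 1 1)) = \<Phi> (half_proj n i j 1 1)" if "i < n" "j < n" "i \<noteq> j" for i j
    unfolding transpose_eq_star[symmetric] using that
    by (intro sym half_proj_props) (auto simp: half_proj_def outer_mat_def intro!: eq_matI)
  show ?thesis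
    by (rule zpp_structure_selfadjoint[OF _ _ lin zpp unit half])
      (auto simp: transpose_eq_star)
qed

theorem theorem3p5:
  shows
  "(\<forall>n r (\<Phi> :: 'a::field mat \<Rightarrow> 'a mat).
      linear_mat_map n r \<Phi> \<and> zero_product_preserving n r \<Phi> \<longrightarrow>
        (\<exists>k S T R1 \<Phi>0. S * T = 1\<^sub>m r \<and> T * S = 1\<^sub>m r \<and> star_form n r \<Phi> k S T R1 \<Phi>0) \<and>
        ((\<forall>A \<in> carrier_mat n n. mat_rank A = 1 \<and> A * A = A \<longrightarrow> \<Phi> A * \<Phi> A = \<Phi> A) \<longrightarrow>
          (\<exists>k S T R1. S * T = 1\<^sub>m r \<and> T * S = 1\<^sub>m r \<and>
             star_form n r \<Phi> k S T R1 (\<lambda>A. 0\<^sub>m (r - n * k) (r - n * k)))))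
   \<and>
   (\<forall>n r (\<Phi> :: complex mat \<Rightarrow> complex mat).
      linear_mat_map n r \<Phi> \<and> zero_product_preserving n r \<Phi> \<and>
      (\<forall>A \<in> carrier_mat n n. mat_rank A = 1 \<and> A * A = A \<and> mat_adjoint A = A \<longrightarrow>
          mat_adjoint (\<Phi> A) = \<Phi> A) \<longrightarrow>
      (\<exists>k S R1. S * mat_adjoint S = 1\<^sub>m r \<and> mat_adjoint S * S = 1\<^sub>m r \<and> mat_adjoint R1 = R1 \<and>
          star_form n r \<Phi> k S (mat_adjoint S) R1 (\<lambda>A. 0\<^sub>m (r - n * k) (r - n * k))))
   \<and>
   (\<forall>n r (\<Phi> :: real mat \<Rightarrow> real mat).
      linear_mat_map n r \<Phi> \<and> zero_product_preserving n r \<Phi> \<and>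
      (\<forall>A \<in> carrier_mat n n. mat_rank A = 1 \<and> A * A = A \<and> transpose_mat A = A \<longrightarrow>
          transpose_mat (\<Phi> A) = \<Phi> A) \<longrightarrow>
      (\<exists>k S R1 \<Phi>0. S * transpose_mat S = 1\<^sub>m r \<and> transpose_mat S * S = 1\<^sub>m r \<and>
          star_form n r \<Phi> k S (transpose_mat S) R1 \<Phi>0 \<and>
          (\<forall>A \<in> carrier_mat n n. transpose_mat A = A \<longrightarrow> \<Phi>0 A = 0\<^sub>m (r - n * k) (r - n * k)) \<and>
          (\<forall>X \<in> carrier_mat n n. \<forall>Y \<in> carrier_mat n n. \<Phi>0 X * \<Phi>0 Y = 0\<^sub>m (r - n * k) (r - n * k))))
   \<and>
   (\<forall>n r (\<Phi> :: complex mat \<Rightarrow> complex mat).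
      linear_mat_map n r \<Phi> \<and> zero_product_preserving n r \<Phi> \<and>
      diagonalizable_mat (\<Phi> (1\<^sub>m n)) \<and>
      (\<forall>A \<in> carrier_mat n n. (\<forall>i<n. \<forall>j<n. A $$ (i,j) \<in> \<real>) \<and>
          mat_rank A = 1 \<and> A * A = A \<and> transpose_mat A = A \<longrightarrow>
          transpose_mat (\<Phi> A) = \<Phi> A) \<longrightarrow>
      (\<exists>k S R1 \<Phi>0. S * transpose_mat S = 1\<^sub>m r \<and> transpose_mat S * S = 1\<^sub>m r \<and>
          transpose_mat R1 = R1 \<and> star_form n r \<Phi> k S (transpose_mat S) R1 \<Phi>0))"
  apply (intro conjI allI impI; elim conjE)
  subgoal by (rule zpp_general(1); assumption)
  subgoal by (rule zpp_general(2); (assumption | blast))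
  subgoal by (rule zpp_hermitian; (assumption | blast))
  subgoal by (rule zpp_real_symmetric; (assumption | blast))
  subgoal by (rule zpp_complex_symmetric; (assumption | blast))
  done

end
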